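(* Let $K \in \{\mathbb{R}, \mathbb{C}, \mathbb{H}\}$, and let $n_K \in \mathbb{N}$ be equal to $3$ when $K = \mathbb{R}$, and equal to $2$ when $K = \mathbb{C}$ or $\mathbb{H}$. Then for any $n \geq n_K$ and any sequence $(d_1, d_2, \ldots, d_k)$ of integers satisfying $0 < d_1 < d_2 < \cdots < d_k = n$, the flag manifold $F(d_1, d_2, \ldots, d_k, K)$ is $G(n,K)$-paradoxical.
   Context: $\mathbb{H}$ denotes the quaternion algebra. For $K = \mathbb{R}, \mathbb{C}, \mathbb{H}$, $K^n$ is regarded as an $n$-dimensional right $K$-vector space with inner product $(x,y) := \bar{x}_1 y_1 + \cdots + \bar{x}_n y_n$ for $x,y\in K^n$ and metric $d(x,y) := \sqrt{(x-y,x-y)}$. $G(n,K)$ denotes the group of $K$-linear isometries of $K^n$, i.e. the compact Lie group $O(n)$, $U(n)$, $Sp(n)$ for $K = \mathbb{R}, \mathbb{C}, \mathbb{H}$ respectively. For $0 < d_1 < \cdots < d_k = n$, a partial flag of index $(d_1, \ldots, d_k)$ is a strictly increasing sequence of right $K$-subspaces $\{0\} = V_0 \subset V_1 \subset \cdots \subset V_k = K^n$ with $\dim_K V_i = d_i$. The flag manifold $F(d_1, \ldots, d_k, K)$ is the set of all partial flags of index $(d_1, \ldots, d_k)$. $G(n,K)$ acts on it transitively by $g\cdot(V_0 \subset \cdots \subset V_k) = (gV_0 \subset \cdots \subset gV_k)$. Let a group $G$ act on a non-empty set $X$. Non-empty subsets $A, B \subset X$ are called $G$-equidecomposable if there exist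 finitely many elements $g_1, \ldots, g_m \in G$ and partitions $A = \bigsqcup_{i=1}^m A_i$, $B = \bigsqcup_{i=1}^m B_i$ such that $A_i = g_i B_i$ for all $i$. A non-empty subset $E \subset X$ is called $G$-paradoxical if there exist disjoint subsets $A, B$ of $E$ such that $A$ is $G$-equidecomposable to $E$ and $B$ is also $G$-equidecomposable to $E$. (Here $E$ is the whole set $X = F(d_1, \ldots, d_k, K)$.)
   Formalization: The sequence (d_1,…,d_k) is required to have k ≥ 2: for k = 1 the flag manifold F(n,K) is the single flag {0} ⊂ K^n, and a one-point set is never paradoxical, so the claim fails there. *)

theory Defs
  imports "HOL-Analysis.Analysis" "HOL-Algebra.Group_Action"
begin

section \<open>Quaternions\<close>

datatype quat = Quat (qre: real) (qi: real) (qj: real) (qk: real)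

lemma quat_eq_iff: "x = y \<longleftrightarrow> qre x = qre y \<and> qi x = qi y \<and> qj x = qj y \<and> qk x = qk y"
  by (cases x; cases y) auto

instantiation quat :: real_normed_div_algebra
begin

definition zero_quat :: quat where "0 = Quat 0 0 0 0"
definition one_quat :: quat where "1 = Quat 1 0 0 0"
definition plus_quat :: "quat \<Rightarrow> quat \<Rightarrow> quat" where
  "x + y = Quat (qre x + qre y) (qi x + qi y) (qj x + qj y) (qk x + qk y)"
definition minus_quat :: "quat \<Rightarrow> quat \<Rightarrow> quat" where
  "x - y = Quat (qre x - qre y) (qi x - qi y) (qj x - qj y) (qk x - qk y)"
definition uminus_quat :: "quat \<Rightarrow> quat" where
  "- x = Quat (- qre x) (- qi x) (- qj x) (- qk x)"
definition times_quat :: "quat \<Rightarrow> quat \<Rightarrow> quat" where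
  "x * y = Quat
     (qre x * qre y - qi x * qi y - qj x * qj y - qk x * qk y)
     (qre x * qi y + qi x * qre y + qj x * qk y - qk x * qj y)
     (qre x * qj y - qi x * qk y + qj x * qre y + qk x * qi y)
     (qre x * qk y + qi x * qj y - qj x * qi y + qk x * qre y)"
definition scaleR_quat :: "real \<Rightarrow> quat \<Rightarrow> quat" where
  "r *\<^sub>R x = Quat (r * qre x) (r * qi x) (r * qj x) (r * qk x)"
definition norm_quat :: "quat \<Rightarrow> real" where
  "norm x = sqrt ((qre x)\<^sup>2 + (qi x)\<^sup>2 + (qj x)\<^sup>2 + (qk x)\<^sup>2)"
definition inverse_quat :: "quat \<Rightarrow> quat" where
  "inverse x = inverse ((norm x)\<^sup>2) *\<^sub>R Quat (qre x) (- qi x) (- qj x) (- qk x)"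
definition divide_quat :: "quat \<Rightarrow> quat \<Rightarrow> quat" where
  "x div y = x * inverse (y :: quat)"
definition sgn_quat :: "quat \<Rightarrow> quat" where
  "sgn x = inverse (norm x) *\<^sub>R (x :: quat)"
definition dist_quat :: "quat \<Rightarrow> quat \<Rightarrow> real" where
  "dist x y = norm (x - y :: quat)"
definition uniformity_quat :: "(quat \<times> quat) filter" where
  "uniformity = (INF e\<in>{0<..}. principal {(x, y). dist x (y :: quat) < e})"
definition open_quat :: "quat set \<Rightarrow> bool" where
  "open U \<longleftrightarrow> (\<forall>x\<in>U. \<forall>\<^sub>F (x', y) in uniformity. x' = (x :: quat) \<longrightarrow> y \<in> U)"

lemmas quat_ops = zero_quat_def one_quat_def plus_quat_def minus_quat_def uminus_quat_def
  times_quat_def scaleR_quat_def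

lemma norm_quat_squared: "(norm x)\<^sup>2 = (qre x)\<^sup>2 + (qi x)\<^sup>2 + (qj x)\<^sup>2 + (qk x)\<^sup>2"
  for x :: quat
  by (simp add: norm_quat_def)

lemma norm_quat_pair:
  "norm x = norm ((Complex (qre x) (qi x)), (Complex (qj x) (qk x)))" for x :: quat
  by (simp add: norm_quat_def norm_Pair complex_norm add.assoc)

instance
proof
  fix x y z :: quat and a b :: real
  show "x + y + z = x + (y + z)" "x + y = y + x" "0 + x = x" "- x + x = 0" "x - y = x + - y"
    "a *\<^sub>R (x + y) = a *\<^sub>R x + a *\<^sub>R y" "(a + b) *\<^sub>R x = a *\<^sub>R x + b *\<^sub>R x"
    "a *\<^sub>R b *\<^sub>R x = (a * b) *\<^sub>R x" "1 *\<^sub>R x = x"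
    "1 * x = x" "x * 1 = x" "(x + y) * z = x * z + y * z" "x * (y + z) = x * y + x * z"
    "(a *\<^sub>R x) * y = a *\<^sub>R (x * y)" "x * (a *\<^sub>R y) = a *\<^sub>R (x * y)"
    "x * y * z = x * (y * z)" "(0::quat) \<noteq> 1"
    by (simp_all add: quat_ops algebra_simps)
  show nz: "norm x = 0 \<longleftrightarrow> x = 0"
    by (auto simp: norm_quat_pair quat_eq_iff zero_quat_def complex_eq_iff zero_prod_def)
  show "norm (x + y) \<le> norm x + norm y"
    using norm_triangle_ineq[of "(Complex (qre x) (qi x), Complex (qj x) (qk x))"
        "(Complex (qre y) (qi y), Complex (qj y) (qk y))"]
    by (simp add: norm_quat_pair plus_quat_def complex_add)
  show "norm (a *\<^sub>R x) = \<bar>a\<bar> * norm x"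
  proof -
    have "norm (a *\<^sub>R x) = sqrt (a\<^sup>2 * ((qre x)\<^sup>2 + (qi x)\<^sup>2 + (qj x)\<^sup>2 + (qk x)\<^sup>2))"
      by (simp add: norm_quat_def scaleR_quat_def power_mult_distrib algebra_simps)
    then show ?thesis
      by (simp add: real_sqrt_mult norm_quat_def)
  qed
  show "norm (x * y) = norm x * norm y"
  proof -
    have "(norm (x * y))\<^sup>2 = (norm x)\<^sup>2 * (norm y)\<^sup>2"
      unfolding norm_quat_squared by (simp add: times_quat_def power2_eq_square algebra_simps)
    then have "(norm (x * y))\<^sup>2 = (norm x * norm y)\<^sup>2"
      by (simp only: power_mult_distrib)
    moreover have "norm (x * y) \<ge> 0" "norm x * norm y \<ge> 0"
      unfolding norm_quat_def by (simp_all only: real_sqrt_ge_zero mult_nonneg_nonneg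
          add_nonneg_nonneg zero_le_power2)
    ultimately show ?thesis
      by (rule power2_eq_imp_eq)
  qed
  show "inverse x * x = 1" "x * inverse x = 1" if "x \<noteq> 0"
  proof -
    define r where "r = inverse ((norm x)\<^sup>2)"
    have r: "r * ((qre x)\<^sup>2 + (qi x)\<^sup>2 + (qj x)\<^sup>2 + (qk x)\<^sup>2) = 1"
      unfolding r_def norm_quat_squared[symmetric] using that nz by simp
    have "inverse x * x = Quat (r * ((qre x)\<^sup>2 + (qi x)\<^sup>2 + (qj x)\<^sup>2 + (qk x)\<^sup>2)) 0 0 0"
      "x * inverse x = Quat (r * ((qre x)\<^sup>2 + (qi x)\<^sup>2 + (qj x)\<^sup>2 + (qk x)\<^sup>2)) 0 0 0"
      unfolding inverse_quat_def r_def[symmetric]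
      by (simp_all add: times_quat_def scaleR_quat_def power2_eq_square algebra_simps)
    then show "inverse x * x = 1" "x * inverse x = 1"
      unfolding r by (simp_all only: one_quat_def)
  qed
  show "inverse (0::quat) = 0"
    by (simp add: inverse_quat_def quat_ops)
  show "x div y = x * inverse y" "sgn x = inverse (norm x) *\<^sub>R x" "dist x y = norm (x - y)"
    by (simp_all add: divide_quat_def sgn_quat_def dist_quat_def)
  show "uniformity = (INF e\<in>{0<..}. principal {(x::quat, y). dist x y < e})"
    by (rule uniformity_quat_def)
  show "open U \<longleftrightarrow> (\<forall>x\<in>U. \<forall>\<^sub>F (x', y) in uniformity. x' = x \<longrightarrow> y \<in> U)" for U :: "quat set"
    by (rule open_quat_def)
qed

end

lemma of_real_quat: "(of_real r :: quat) = Quat r 0 0 0"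
  by (simp add: of_real_def one_quat_def scaleR_quat_def)


section \<open>Conjugation on the real, complex and quaternion algebras\<close>

class conj_div_algebra = real_normed_div_algebra +
  fixes kconj :: "'a \<Rightarrow> 'a"
  assumes kconj_add: "kconj (x + y) = kconj x + kconj y"
    and kconj_mult_self_scaleR: "kconj x * x = ((norm x)\<^sup>2) *\<^sub>R 1"

lemma kconj_mult_self: "kconj x * x = of_real ((norm x)\<^sup>2)"
  by (simp add: kconj_mult_self_scaleR of_real_def)

instantiation real :: conj_div_algebra
begin
definition kconj_real :: "real \<Rightarrow> real" where "kconj x = (x :: real)"
instance by standard (simp_all add: kconj_real_def power2_eq_square)
end

instantiation complex :: conj_div_algebra
begin
definition kconj_complex :: "complex \<Rightarrow> complex" where "kconj x = cnj x"
instance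
proof
  fix x y :: complex
  show "kconj (x + y) = kconj x + kconj y" by (simp add: kconj_complex_def)
  have "cnj x * x = of_real ((norm x)\<^sup>2)"
    using complex_norm_square[of x] by (simp only: mult.commute[of "cnj x" x])
  then show "kconj x * x = ((norm x)\<^sup>2) *\<^sub>R 1"
    by (simp only: kconj_complex_def of_real_def)
qed
end

instantiation quat :: conj_div_algebra
begin
definition kconj_quat :: "quat \<Rightarrow> quat" where
  "kconj x = Quat (qre x) (- qi x) (- qj x) (- qk x)"
instance
proof
  fix x y :: quat
  show "kconj (x + y) = kconj x + kconj y"
    by (simp add: kconj_quat_def plus_quat_def)
  show "kconj x * x = ((norm x)\<^sup>2) *\<^sub>R 1"
    unfolding norm_quat_squared
    by (simp add: kconj_quat_def times_quat_def scaleR_quat_def one_quat_def power2_eq_square)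
qed
end


section \<open>The right inner product space and its isometry group\<close>

definition kinner :: "('a::conj_div_algebra)^'n \<Rightarrow> 'a^'n \<Rightarrow> 'a" where
  "kinner x y = (\<Sum>i\<in>UNIV. kconj (x $ i) * y $ i)"

text \<open>
  The inner product of a vector with itself is a nonnegative real scalar; \<open>norm\<close> only reads it
  off as an element of type \<^typ>\<open>real\<close> (see \<open>kinner_self\<close> and \<open>kdist_squared\<close> below).
\<close>

definition kdist :: "('a::conj_div_algebra)^'n \<Rightarrow> 'a^'n \<Rightarrow> real" where
  "kdist x y = sqrt (norm (kinner (x - y) (x - y)))"

lemma kinner_self: "kinner x x = of_real ((norm x)\<^sup>2)"
proof -
  have "(norm x)\<^sup>2 = (\<Sum>i\<in>UNIV. (norm (x $ i))\<^sup>2)"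
    unfolding norm_vec_def L2_set_def by (intro real_sqrt_pow2 sum_nonneg zero_le_power2)
  then show ?thesis
    unfolding kinner_def kconj_mult_self by (simp only: of_real_sum)
qed

lemma kdist_eq_dist: "kdist x y = dist x y"
  by (simp add: kdist_def kinner_self dist_norm norm_power)

lemma kdist_squared: "of_real ((kdist x y)\<^sup>2) = kinner (x - y) (x - y)"
  by (simp add: kdist_eq_dist kinner_self dist_norm)

definition rscale :: "('a::conj_div_algebra)^'n \<Rightarrow> 'a \<Rightarrow> 'a^'n" where
  "rscale v c = (\<chi> i. v $ i * c)"

definition right_linear :: "(('a::conj_div_algebra)^'n \<Rightarrow> 'a^'n) \<Rightarrow> bool" where
  "right_linear g \<longleftrightarrow> (\<forall>x y. g (x + y) = g x + g y) \<and> (\<forall>x c. g (rscale x c) = rscale (g x) c)"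

text \<open>
  The condition \<open>bij g\<close> is redundant in finite dimension; it makes the group structure immediate.
\<close>

definition isometry_group :: "(('a::conj_div_algebra)^'n \<Rightarrow> 'a^'n) monoid" where
  "isometry_group = \<lparr>carrier = {g. bij g \<and> right_linear g \<and> (\<forall>x y. kdist (g x) (g y) = kdist x y)},
                     mult = (\<circ>), one = id\<rparr>"

lemma group_isometry_group: "group (isometry_group :: (('a::conj_div_algebra)^'n \<Rightarrow> 'a^'n) monoid)"
proof (rule groupI)
  fix g :: "'a^'n \<Rightarrow> 'a^'n" assume g: "g \<in> carrier isometry_group"
  then have b: "bij g" and l: "right_linear g" and d: "\<And>x y. kdist (g x) (g y) = kdist x y"
    by (auto simp: isometry_group_def)
  have gi: "g (inv_into UNIV g x) = x" "inv_into UNIV g (g x) = x" for x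
    using b by (auto simp: bij_is_surj surj_f_inv_f bij_is_inj)
  have "inv_into UNIV g (x + y) = inv_into UNIV g x + inv_into UNIV g y" for x y
    using l gi unfolding right_linear_def by metis
  moreover have "inv_into UNIV g (rscale x c) = rscale (inv_into UNIV g x) c" for x c
    using l gi unfolding right_linear_def by metis
  moreover have "kdist (inv_into UNIV g x) (inv_into UNIV g y) = kdist x y" for x y
    using d gi by metis
  ultimately have "inv_into UNIV g \<in> carrier isometry_group"
    using b by (auto simp: isometry_group_def right_linear_def bij_imp_bij_inv)
  moreover have "inv_into UNIV g \<otimes>\<^bsub>isometry_group\<^esub> g = \<one>\<^bsub>isometry_group\<^esub>"
    using gi by (auto simp: isometry_group_def)
  ultimately show "\<exists>h\<in>carrier isometry_group. h \<otimes>\<^bsub>isometry_group\<^esub> g = \<one>\<^bsub>isometry_group\<^esub>"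
    by blast
qed (auto simp: isometry_group_def right_linear_def bij_comp comp_assoc)


section \<open>Right subspaces and flags\<close>

text \<open>
  The scalars need not commute, so the \<open>vector_space\<close> locale and its \<open>subspace\<close>, \<open>span\<close> and \<open>dim\<close>
  do not apply uniformly.
\<close>

definition right_subspace :: "(('a::conj_div_algebra)^'n) set \<Rightarrow> bool" where
  "right_subspace V \<longleftrightarrow> 0 \<in> V \<and> (\<forall>x\<in>V. \<forall>y\<in>V. x + y \<in> V) \<and> (\<forall>x\<in>V. \<forall>c. rscale x c \<in> V)"

definition right_basis :: "(('a::conj_div_algebra)^'n) set \<Rightarrow> ('a^'n) set \<Rightarrow> bool" where
  "right_basis B V \<longleftrightarrow> finite B
     \<and> (\<forall>c. (\<Sum>b\<in>B. rscale b (c b)) = 0 \<longrightarrow> (\<forall>b\<in>B. c b = 0))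
     \<and> V = {\<Sum>b\<in>B. rscale b (c b) |c. True}"

definition has_right_dim :: "(('a::conj_div_algebra)^'n) set \<Rightarrow> nat \<Rightarrow> bool" where
  "has_right_dim V d \<longleftrightarrow> (\<exists>B. right_basis B V \<and> card B = d)"

text \<open>
  For \<open>ds = [d\<^sub>1, \<dots>, d\<^sub>k]\<close>, a flag is the list \<open>[V\<^sub>0, \<dots>, V\<^sub>k]\<close>; note the shift of indices
  between \<open>ds\<close> and \<open>Vs\<close>.
\<close>

definition flag_manifold :: "nat list \<Rightarrow> (('a::conj_div_algebra)^'n) set list set" where
  "flag_manifold ds = {Vs. length Vs = Suc (length ds)
     \<and> (\<forall>V\<in>set Vs. right_subspace V)
     \<and> Vs ! 0 = {0} \<and> Vs ! length ds = UNIV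
     \<and> (\<forall>i<length ds. Vs ! i \<subset> Vs ! Suc i)
     \<and> (\<forall>i<length ds. has_right_dim (Vs ! Suc i) (ds ! i))}"

definition flag_action ::
  "nat list \<Rightarrow> (('a::conj_div_algebra)^'n \<Rightarrow> 'a^'n) \<Rightarrow> ('a^'n) set list \<Rightarrow> ('a^'n) set list" where
  "flag_action ds g = (\<lambda>Vs\<in>flag_manifold ds. map (\<lambda>V. g ` V) Vs)"

lemma right_linear_0: "right_linear g \<Longrightarrow> g 0 = 0"
  unfolding right_linear_def by (metis add_cancel_left_left)

lemma right_linear_sum: "right_linear g \<Longrightarrow> g (\<Sum>b\<in>B. f b) = (\<Sum>b\<in>B. g (f b))"
  by (induction B rule: infinite_finite_induct)
    (auto simp: right_linear_0 right_linear_def)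

lemma has_right_dim_image:
  assumes "bij g" "right_linear g" "has_right_dim V d"
  shows "has_right_dim (g ` V) d"
proof -
  from assms(3) obtain B where B: "finite B" "card B = d"
    "\<And>c. (\<Sum>b\<in>B. rscale b (c b)) = 0 \<Longrightarrow> \<forall>b\<in>B. c b = 0"
    "V = {\<Sum>b\<in>B. rscale b (c b) |c. True}"
    unfolding has_right_dim_def right_basis_def by blast
  have inj: "inj g" using assms(1) by (rule bij_is_inj)
  have eq: "(\<Sum>b\<in>g ` B. rscale b (c b)) = g (\<Sum>b\<in>B. rscale b (c (g b)))" for c
    using inj assms(2)
    by (simp add: sum.reindex[OF inj_on_subset[OF inj]] right_linear_sum right_linear_def)
  have "right_basis (g ` B) (g ` V)"
    unfolding right_basis_def
  proof (intro conjI allI impI)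
    show "finite (g ` B)" using B(1) by simp
    fix c assume "(\<Sum>b\<in>g ` B. rscale b (c b)) = 0"
    then have "(\<Sum>b\<in>B. rscale b (c (g b))) = 0"
      using eq inj right_linear_0[OF assms(2)] by (metis injD)
    then show "\<forall>b\<in>g ` B. c b = 0" using B(3)[of "\<lambda>b. c (g b)"] by blast
  next
    have "g (\<Sum>b\<in>B. rscale b (c b)) = (\<Sum>b\<in>g ` B. rscale b (c (inv_into UNIV g b)))" for c
      unfolding eq using inj by simp
    then have "\<exists>c'. g (\<Sum>b\<in>B. rscale b (c b)) = (\<Sum>b\<in>g ` B. rscale b (c' b))" for c
      by (intro exI[of _ "\<lambda>b. c (inv_into UNIV g b)"])
    note fwd = this
    show "g ` V = {\<Sum>b\<in>g ` B. rscale b (c b) |c. True}"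
    proof (intro equalityI subsetI)
      fix y assume "y \<in> g ` V"
      then obtain c where "y = g (\<Sum>b\<in>B. rscale b (c b))" unfolding B(4) by auto
      with fwd[of c] show "y \<in> {\<Sum>b\<in>g ` B. rscale b (c b) |c. True}" by simp
    next
      fix y assume "y \<in> {\<Sum>b\<in>g ` B. rscale b (c b) |c. True}"
      then obtain c where "y = (\<Sum>b\<in>g ` B. rscale b (c b))" by auto
      then have "y = g (\<Sum>b\<in>B. rscale b (c (g b)))" by (simp only: eq)
      then show "y \<in> g ` V" unfolding B(4) by (intro image_eqI) auto
    qed
  qed
  moreover have "card (g ` B) = d"
    using B(2) inj by (simp add: card_image inj_on_subset)
  ultimately show ?thesis unfolding has_right_dim_def by blast
qed

lemma flag_image:
  assumes g: "g \<in> carrier isometry_group" and V: "Vs \<in> flag_manifold ds"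
  shows "map (\<lambda>V. g ` V) Vs \<in> flag_manifold ds"
proof -
  have b: "bij g" and l: "right_linear g" using g by (auto simp: isometry_group_def)
  have "right_subspace (g ` V)" if "right_subspace V" for V
    unfolding right_subspace_def
  proof (intro conjI ballI allI)
    show "0 \<in> g ` V"
      using that right_linear_0[OF l] unfolding right_subspace_def by (metis image_eqI)
  next
    fix x y assume "x \<in> g ` V" "y \<in> g ` V"
    then obtain u v where "x = g u" "y = g v" "u \<in> V" "v \<in> V" by blast
    then have "x + y = g (u + v)" "u + v \<in> V"
      using that l by (auto simp: right_subspace_def right_linear_def)
    then show "x + y \<in> g ` V" by blast
  next
    fix x c assume "x \<in> g ` V"
    then obtain u where "x = g u" "u \<in> V" by blast
    then have "rscale x c = g (rscale u c)" "rscale u c \<in> V"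
      using that l by (auto simp: right_subspace_def right_linear_def)
    then show "rscale x c \<in> g ` V" by blast
  qed
  moreover have "g ` A \<subset> g ` B" if "A \<subset> B" for A B
    using that bij_is_inj[OF b] by (auto simp: psubset_eq inj_image_eq_iff)
  moreover have "g ` UNIV = UNIV" using b by (simp add: bij_is_surj)
  ultimately show ?thesis
    using V has_right_dim_image[OF b l] right_linear_0[OF l]
    by (auto simp: flag_manifold_def)
qed

lemma group_action_flag_action:
  "group_action (isometry_group :: (('a::conj_div_algebra)^'n \<Rightarrow> 'a^'n) monoid)
     (flag_manifold ds) (flag_action ds)"
proof -
  let ?G = "isometry_group :: ('a^'n \<Rightarrow> 'a^'n) monoid"
  let ?F = "flag_manifold ds :: ('a^'n) set list set"
  interpret group ?G by (rule group_isometry_group)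
  have comp: "flag_action ds (g \<otimes>\<^bsub>?G\<^esub> h) = compose ?F (flag_action ds g) (flag_action ds h)"
    if "g \<in> carrier ?G" "h \<in> carrier ?G" for g h
  proof -
    have [simp]: "g \<otimes>\<^bsub>?G\<^esub> h = g \<circ> h" by (simp add: isometry_group_def)
    show ?thesis
      by (rule ext) (simp add: flag_action_def compose_def flag_image[OF that(2)]
          restrict_def image_comp comp_def image_image)
  qed
  have one: "flag_action ds \<one>\<^bsub>?G\<^esub> = (\<lambda>V\<in>?F. V)"
    by (rule ext) (simp add: flag_action_def isometry_group_def restrict_def map_idI)
  have maps: "flag_action ds g \<in> ?F \<rightarrow> ?F" if "g \<in> carrier ?G" for g
    using flag_image[OF that] by (auto simp: flag_action_def)
  have invl: "flag_action ds (inv\<^bsub>?G\<^esub> g) (flag_action ds g V) = V"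
    if "g \<in> carrier ?G" "V \<in> ?F" for g V
    using fun_cong[OF comp[of "inv\<^bsub>?G\<^esub> g" g], of V] that one by (simp add: compose_def)
  have Bij: "flag_action ds g \<in> Bij ?F" if g: "g \<in> carrier ?G" for g
  proof -
    have "bij_betw (flag_action ds g) ?F ?F"
      by (rule bij_betwI[of _ _ _ "flag_action ds (inv\<^bsub>?G\<^esub> g)"])
        (use maps invl[OF g] invl[of "inv\<^bsub>?G\<^esub> g"] g in auto)
    then show ?thesis by (simp add: Bij_def flag_action_def)
  qed
  have "flag_action ds \<in> hom ?G (BijGroup ?F)"
  proof (rule homI)
    fix g h assume gh: "g \<in> carrier ?G" "h \<in> carrier ?G"
    show "flag_action ds g \<in> carrier (BijGroup ?F)"
      using Bij[OF gh(1)] by (simp add: BijGroup_def)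
    show "flag_action ds (g \<otimes>\<^bsub>?G\<^esub> h) = flag_action ds g \<otimes>\<^bsub>BijGroup ?F\<^esub> flag_action ds h"
      using Bij[OF gh(1)] Bij[OF gh(2)] comp[OF gh] by (simp add: BijGroup_def)
  qed
  then show ?thesis
    unfolding group_action_def group_hom_def group_hom_axioms_def
    by (intro conjI group_isometry_group group_BijGroup)
qed


section \<open>Equidecomposability and paradoxical sets\<close>

text \<open>
  \<open>\<phi>\<close> is an action of \<open>G\<close> in the sense of \<^locale>\<open>group_action\<close>.
\<close>

definition equidecomposable ::
  "('g, 'm) monoid_scheme \<Rightarrow> ('g \<Rightarrow> 'x \<Rightarrow> 'x) \<Rightarrow> 'x set \<Rightarrow> 'x set \<Rightarrow> bool" where
  "equidecomposable G \<phi> A B \<longleftrightarrow> A \<noteq> {} \<and> B \<noteq> {} \<and>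
     (\<exists>(m::nat) g P Q.
        (\<forall>i<m. g i \<in> carrier G \<and> P i = \<phi> (g i) ` Q i)
        \<and> disjoint_family_on P {..<m} \<and> A = (\<Union>i<m. P i)
        \<and> disjoint_family_on Q {..<m} \<and> B = (\<Union>i<m. Q i))"

definition paradoxical ::
  "('g, 'm) monoid_scheme \<Rightarrow> ('g \<Rightarrow> 'x \<Rightarrow> 'x) \<Rightarrow> 'x set \<Rightarrow> bool" where
  "paradoxical G \<phi> E \<longleftrightarrow> E \<noteq> {} \<and>
     (\<exists>A B. A \<subseteq> E \<and> B \<subseteq> E \<and> A \<inter> B = {}
        \<and> equidecomposable G \<phi> A E \<and> equidecomposable G \<phi> B E)"

text \<open>
  A flag manifold of index \<open>[n]\<close> consists of the single flag \<open>{0} \<subset> K\<^sup>n\<close>; the following shows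
  that it is not paradoxical, so flags need at least one proper intermediate subspace.
\<close>

lemma not_paradoxical_singleton: "\<not> paradoxical G \<phi> {x}"
proof
  assume "paradoxical G \<phi> {x}"
  then obtain A B where "A \<subseteq> {x}" "B \<subseteq> {x}" "A \<inter> B = {}"
    and "equidecomposable G \<phi> A {x}" "equidecomposable G \<phi> B {x}"
    unfolding paradoxical_def by auto
  moreover from this have "A \<noteq> {}" "B \<noteq> {}"
    by (simp_all add: equidecomposable_def)
  ultimately show False
    by (metis Int_absorb subset_singletonD)
qed

end

theory Submission
  imports Defs
begin

text \<open>
  The integer quaternions \<open>1 \<plusminus> 2i\<close>, \<open>1 \<plusminus> 2j\<close> generate, up to scalars, a free group: modulo \<open>5\<close> no
  nonempty reduced word is real. Let unit quaternions act on \<open>K\<^sup>n\<close> through three coordinates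
  (\<open>SO(3)\<close>, \<open>K = \<real>\<close>), two coordinates (\<open>SU(2)\<close>, \<open>K = \<complex>\<close>) or one coordinate (\<open>Sp(1)\<close>, over
  the quaternions). On the set of flags not fixed by any non-real word the free group gives a
  paradoxical decomposition. A decomposition extends from a subset to the whole space as soon as finitely
  many group elements suffice to move every point into the subset, because a paradoxical set absorbs
  any finite number of copies of itself.

  If a word \<open>u\<close> fixes a flag, then the subspace \<open>V = V\<^sub>1\<close> is stable under \<open>\<rho> u - \<rho> (kconj u)\<close>, which is
  proportional to the infinitesimal action of the imaginary part of \<open>u\<close>. Requiring this for \<open>V\<close> and for
  finitely many of its images makes \<open>V\<close> stable under the whole Lie algebra acting on any chosen
  coordinates, so that \<open>V = 0\<close> or \<open>V = K\<^sup>n\<close>. No such \<open>V\<close> occurs in a flag with \<open>k \<ge> 2\<close>.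
\<close>

section \<open>Integer quaternions and reduced words\<close>

lemmas quat_simps = quat_eq_iff zero_quat_def one_quat_def plus_quat_def minus_quat_def uminus_quat_def
  times_quat_def scaleR_quat_def kconj_quat_def of_real_quat

lemma quat_sel_simps [simp]:
  "qre (x + y) = qre x + qre y" "qi (x + y) = qi x + qi y"
  "qj (x + y) = qj x + qj y" "qk (x + y) = qk x + qk y"
  "qre (x - y) = qre x - qre y" "qi (x - y) = qi x - qi y"
  "qj (x - y) = qj x - qj y" "qk (x - y) = qk x - qk y"
  "qre (- x) = - qre x" "qi (- x) = - qi x" "qj (- x) = - qj x" "qk (- x) = - qk x"
  "qre (c *\<^sub>R x) = c * qre x" "qi (c *\<^sub>R x) = c * qi x"
  "qj (c *\<^sub>R x) = c * qj x" "qk (c *\<^sub>R x) = c * qk x"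
  "qre (kconj x) = qre x" "qi (kconj x) = - qi x"
  "qj (kconj x) = - qj x" "qk (kconj x) = - qk x"
  "qre 0 = 0" "qi 0 = 0" "qj 0 = 0" "qk 0 = 0"
  by (simp_all add: quat_simps)

lemma kconj_quat_mult: "kconj (x * y) = kconj y * kconj x" for x y :: quat
  by (simp add: quat_simps algebra_simps)

lemma kconj_quat_kconj [simp]: "kconj (kconj x) = x" for x :: quat
  by (simp add: quat_simps)

lemma mult_kconj_quat: "x * kconj x = of_real ((norm x)\<^sup>2)" for x :: quat
  unfolding norm_quat_squared by (simp add: quat_simps algebra_simps power2_eq_square)

lemma norm_kconj_quat [simp]: "norm (kconj x) = norm x" for x :: quat
  by (simp add: norm_quat_def)

lemma kconj_quat_eq_0_iff [simp]: "kconj x = 0 \<longleftrightarrow> x = 0" for x :: quat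
  by (metis norm_kconj_quat norm_eq_zero)

lemma quat_Reals_iff: "x \<in> \<real> \<longleftrightarrow> qi x = 0 \<and> qj x = 0 \<and> qk x = 0"
proof
  show "qi x = 0 \<and> qj x = 0 \<and> qk x = 0" if "x \<in> \<real>"
    using that by (auto simp: Reals_def of_real_quat)
  assume "qi x = 0 \<and> qj x = 0 \<and> qk x = 0"
  then have "x = of_real (qre x)" by (simp add: quat_simps)
  then show "x \<in> \<real>" by (metis Reals_of_real)
qed

section \<open>The Lipschitz order \<int> + \<int>i + \<int>j + \<int>k and divisibility by 5 in
  it\<close>

definition quat_int :: "quat set" where
  "quat_int = {q. qre q \<in> \<int> \<and> qi q \<in> \<int> \<and> qj q \<in> \<int> \<and> qk q \<in> \<int>}"

lemma quat_int_add: "x \<in> quat_int \<Longrightarrow> y \<in> quat_int \<Longrightarrow> x + y \<in> quat_int"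
  and quat_int_diff: "x \<in> quat_int \<Longrightarrow> y \<in> quat_int \<Longrightarrow> x - y \<in> quat_int"
  and quat_int_mult: "x \<in> quat_int \<Longrightarrow> y \<in> quat_int \<Longrightarrow> x * y \<in> quat_int"
  by (auto simp: quat_int_def times_quat_def)

definition dvd5 :: "quat \<Rightarrow> bool" where
  "dvd5 q \<longleftrightarrow> (\<exists>p\<in>quat_int. q = 5 *\<^sub>R p)"

lemma dvd5_add: "dvd5 x \<Longrightarrow> dvd5 y \<Longrightarrow> dvd5 (x + y)"
  unfolding dvd5_def by (metis quat_int_add scaleR_add_right)

lemma dvd5_diff: "dvd5 x \<Longrightarrow> dvd5 y \<Longrightarrow> dvd5 (x - y)"
  unfolding dvd5_def by (metis quat_int_diff scaleR_diff_right)

lemma dvd5_mult: "x \<in> quat_int \<Longrightarrow> dvd5 y \<Longrightarrow> dvd5 (x * y)"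
  unfolding dvd5_def by (metis quat_int_mult mult_scaleR_right)

text \<open>Elements of squared norm 5, so \<open>kconj s\<close> is the inverse of \<open>s\<close>
  up to the scalar 5 and serves as the inverse letter.\<close>

inductive_set letters :: "quat set" where
  "Quat 1 2 0 0 \<in> letters"
| "Quat 1 (-2) 0 0 \<in> letters"
| "Quat 1 0 2 0 \<in> letters"
| "Quat 1 0 (-2) 0 \<in> letters"

lemma letters_int: "s \<in> letters \<Longrightarrow> s \<in> quat_int"
  by (auto elim!: letters.cases simp: quat_int_def)

lemma kconj_letters: "s \<in> letters \<Longrightarrow> kconj s \<in> letters"
  by (auto elim!: letters.cases simp: kconj_quat_def intro: letters.intros)

lemma letters_mult_kconj: "s \<in> letters \<Longrightarrow> s * kconj s = of_real 5"
  by (auto elim!: letters.cases simp: quat_simps)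

text \<open>A word is represented by its value \<open>q\<close>; the first argument records the
  leftmost letter, which is what decides whether a further letter cancels.\<close>

inductive reduced :: "quat \<Rightarrow> quat \<Rightarrow> bool" where
  letter: "s \<in> letters \<Longrightarrow> reduced s s"
| step: "reduced s q \<Longrightarrow> t \<in> letters \<Longrightarrow> t \<noteq> kconj s \<Longrightarrow> reduced t (t * q)"

lemma reduced_letters: "reduced s q \<Longrightarrow> s \<in> letters"
  by (auto elim: reduced.cases)

lemma dvd5_letters_diff:
  assumes "s \<in> letters" "t \<in> letters" "s \<noteq> t" "q \<in> quat_int" "dvd5 (s * q)" "dvd5 (t * q)"
    and "kconj s \<noteq> t"
  shows "dvd5 q"
proof -
  have "dvd5 ((s - t) * q)"
    using assms(5,6) by (simp add: left_diff_distrib dvd5_diff)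
  then have "dvd5 ((s - t) * ((s - t) * q))"
    by (rule dvd5_mult[OF quat_int_diff[OF letters_int[OF assms(1)] letters_int[OF assms(2)]]])
  moreover have "(s - t) * ((s - t) * q) = (-8) *\<^sub>R q"
    using assms(1,2,3,7)
    by (elim letters.cases) (simp_all add: quat_eq_iff times_quat_def kconj_quat_def)
  ultimately obtain p where p: "p \<in> quat_int" "(-8) *\<^sub>R q = 5 *\<^sub>R p"
    unfolding dvd5_def by auto
  \<comment> \<open>Doubling -8q = 5p gives 16q = -10p, and 16 = 15 + 1.\<close>
  have "q = 5 *\<^sub>R (-3 *\<^sub>R q - 2 *\<^sub>R p)"
    using p(2) unfolding quat_eq_iff quat_sel_simps by argo
  moreover have "-3 *\<^sub>R q - 2 *\<^sub>R p \<in> quat_int"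
    using assms(4) p(1) by (auto simp: quat_int_def)
  ultimately show ?thesis unfolding dvd5_def by blast
qed

text \<open>
  Each letter \<open>t\<close> prepended to \<open>q\<close> preserves the invariant, because \<open>s + kconj s = 2\<close>, and
  \<open>(kconj s - t)\<^sup>2 = - 8\<close> is invertible modulo \<open>5\<close> when \<open>s\<close> and \<open>t\<close> have different axes.
\<close>

lemma reduced_mod_5:
  assumes "reduced s q"
  shows "q \<in> quat_int" "dvd5 (kconj s * q)" "\<not> dvd5 q"
proof -
  have l: "dvd5 (kconj s * (s * q))" if "s \<in> letters" "q \<in> quat_int" for s q
  proof -
    have "kconj s * (s * q) = 5 *\<^sub>R q"
      using letters_mult_kconj[OF kconj_letters[OF that(1)]]
      by (simp add: mult.assoc[symmetric] scaleR_conv_of_real)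
    then show ?thesis using that(2) unfolding dvd5_def by blast
  qed
  from assms have "q \<in> quat_int \<and> dvd5 (kconj s * q) \<and> \<not> dvd5 q"
  proof induction
    case (letter s)
    have "\<not> dvd5 s"
    proof
      assume "dvd5 s"
      then obtain x :: real where x: "x \<in> \<int>" "1 = 5 * x"
        using letter by (auto simp: dvd5_def quat_int_def elim!: letters.cases simp: quat_eq_iff)
      from x(1) obtain n where "x = of_int n" by (rule Ints_cases)
      with x(2) have "1 = 5 * n" by linarith
      then show False by presburger
    qed
    moreover have "(1::quat) \<in> quat_int" by (simp add: quat_int_def one_quat_def)
    ultimately show ?case using l[of s 1] letter letters_int by simp
  next
    case (step s q t)
    have s: "s \<in> letters" using step(1) by (rule reduced_letters)
    have "\<not> dvd5 (t * q)"
    proof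
      assume a: "dvd5 (t * q)"
      show False
      proof (cases "t = s")
        case True
        then have "dvd5 (t * q + kconj s * q)" using a step by (intro dvd5_add) auto
        moreover have "t * q + kconj s * q = 2 *\<^sub>R q"
          using True s by (auto elim!: letters.cases simp: quat_simps)
        ultimately obtain p where p: "p \<in> quat_int" "2 *\<^sub>R q = 5 *\<^sub>R p"
          unfolding dvd5_def by auto
        \<comment> \<open>Here q = 5q - 4q, and 4q = 10p.\<close>
        have "q = 5 *\<^sub>R (q - 2 *\<^sub>R p)"
          using p(2) unfolding quat_eq_iff quat_sel_simps by argo
        moreover have "q - 2 *\<^sub>R p \<in> quat_int"
          using step p(1) by (auto simp: quat_int_def)
        ultimately have "dvd5 q" unfolding dvd5_def by blast
        then show False using step by simp
      next
        case False
        then have "dvd5 q"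
          using dvd5_letters_diff[of "kconj s" t q] a step s kconj_letters by force
        then show False using step by simp
      qed
    qed
    then show ?case using step l letters_int quat_int_mult by blast
  qed
  then show "q \<in> quat_int" "dvd5 (kconj s * q)" "\<not> dvd5 q" by auto
qed

text \<open>Letters have real part 1, so for real \<open>q\<close> the real part of
  \<open>kconj s * q\<close> is \<open>q\<close> itself. Divisibility of \<open>kconj s * q\<close>
  by 5 would then pass to \<open>q\<close>.\<close>

lemma reduced_notin_Reals:
  assumes "reduced s q" shows "q \<notin> \<real>"
proof
  assume "q \<in> \<real>"
  then have q: "qi q = 0" "qj q = 0" "qk q = 0" by (auto simp: quat_Reals_iff)
  obtain p where p: "p \<in> quat_int" "kconj s * q = 5 *\<^sub>R p"
    using reduced_mod_5(2)[OF assms] unfolding dvd5_def by blast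
  have "qre (kconj s * q) = qre q"
    using reduced_letters[OF assms] by cases (simp_all add: times_quat_def q)
  then have "qre q = 5 * qre p" using p(2) by simp
  then have "q = 5 *\<^sub>R of_real (qre p)"
    using q by (simp add: quat_eq_iff of_real_quat)
  moreover have "of_real (qre p) \<in> quat_int"
    using p(1) by (simp add: quat_int_def of_real_quat)
  ultimately show False
    using reduced_mod_5(3)[OF assms] unfolding dvd5_def by blast
qed

text \<open>Up to a scalar, \<open>kconj q\<close> is the inverse word of \<open>q\<close>. As the
  first letters of \<open>q\<close> and \<open>q'\<close> differ, nothing cancels where the two
  words meet; the induction moves the letters of \<open>q\<close> over to \<open>q'\<close> one at a
  time.\<close>

lemma reduced_kconj_mult:
  assumes "reduced s q" "reduced s' q'" "s \<noteq> s'"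
  shows "\<exists>t. reduced t (kconj q * q')"
  using assms
proof (induction arbitrary: s' q')
  case (letter s)
  then have "reduced (kconj s) (kconj s * q')"
    by (intro reduced.step[of s'] kconj_letters) (auto dest: arg_cong[of _ _ kconj])
  then show ?case by blast
next
  case (step s q t)
  then have "reduced (kconj t) (kconj t * q')"
    by (intro reduced.step[of s'] kconj_letters) (auto dest: arg_cong[of _ _ kconj])
  moreover have "s \<noteq> kconj t" using step.hyps(3) by auto
  ultimately have "\<exists>u. reduced u (kconj q * (kconj t * q'))" by (rule step.IH)
  then show ?case by (simp add: kconj_quat_mult mult.assoc)
qed

text \<open>Cancellation is allowed here. Up to positive scalars this monoid is a group, because it
  is closed under \<open>kconj\<close>.\<close>

inductive_set words :: "quat set" where
  one: "1 \<in> words"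
| step: "s \<in> letters \<Longrightarrow> q \<in> words \<Longrightarrow> s * q \<in> words"

lemma letters_words: "s \<in> letters \<Longrightarrow> s \<in> words"
  using words.step[OF _ words.one] by simp

lemma words_mult: "p \<in> words \<Longrightarrow> q \<in> words \<Longrightarrow> p * q \<in> words"
  by (induction rule: words.induct) (auto simp: mult.assoc intro: words.step)

lemma kconj_words: "q \<in> words \<Longrightarrow> kconj q \<in> words"
proof (induction rule: words.induct)
  case one
  then show ?case using words.one by (simp add: quat_simps)
next
  case (step s q)
  then show ?case by (simp add: kconj_quat_mult words_mult letters_words kconj_letters)
qed

lemma reduced_words: "reduced s q \<Longrightarrow> q \<in> words"
  by (induction rule: reduced.induct) (auto intro: letters_words words.step)

lemma words_int: "q \<in> words \<Longrightarrow> q \<in> quat_int"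
proof (induction rule: words.induct)
  case one
  show ?case by (simp add: quat_int_def one_quat_def)
qed (simp add: quat_int_mult letters_int)

text \<open>All letters are congruent to 1 modulo 2, hence so are their products, and the real part
  is odd. Later this makes the action of \<open>u\<close> minus that of \<open>kconj u\<close> a
  nonzero multiple of the infinitesimal action.\<close>

lemma words_qre_nonzero:
  assumes "q \<in> words" shows "qre q \<noteq> 0"
proof -
  have "\<exists>a b c d. q = Quat (of_int (2 * a + 1)) (of_int (2 * b)) (of_int (2 * c)) (of_int (2 * d))"
    using assms
  proof induction
    case one
    show ?case by (rule exI[of _ 0], rule exI[of _ 0], rule exI[of _ 0], rule exI[of _ 0])
        (simp add: one_quat_def)
  next
    case (step s q)
    then obtain a b c d where q: "q = Quat (of_int (2 * a + 1)) (of_int (2 * b))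
      (of_int (2 * c)) (of_int (2 * d))" by blast
    from step(1) show ?case
    proof cases
      case 1
      show ?thesis
        by (rule exI[of _ "a - 2 * b"], rule exI[of _ "b + 2 * a + 1"],
            rule exI[of _ "c - 2 * d"], rule exI[of _ "d + 2 * c"]) (simp add: 1 q quat_simps)
    next
      case 2
      show ?thesis
        by (rule exI[of _ "a + 2 * b"], rule exI[of _ "b - 2 * a - 1"],
            rule exI[of _ "c + 2 * d"], rule exI[of _ "d - 2 * c"]) (simp add: 2 q quat_simps)
    next
      case 3
      show ?thesis
        by (rule exI[of _ "a - 2 * c"], rule exI[of _ "b + 2 * d"],
            rule exI[of _ "c + 2 * a + 1"], rule exI[of _ "d - 2 * b"]) (simp add: 3 q quat_simps)
    next
      case 4
      show ?thesis
        by (rule exI[of _ "a + 2 * c"], rule exI[of _ "b - 2 * d"],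
            rule exI[of _ "c - 2 * a - 1"], rule exI[of _ "d + 2 * b"]) (simp add: 4 q quat_simps)
    qed
  qed
  then obtain a :: int where "qre q = of_int (2 * a + 1)" by auto
  moreover have "2 * a + 1 \<noteq> 0" by presburger
  ultimately show ?thesis by (metis of_int_eq_0_iff)
qed

lemma words_nonzero: "q \<in> words \<Longrightarrow> q \<noteq> 0"
  using words_qre_nonzero by fastforce

text \<open>Each cancellation \<open>s * kconj s = 5\<close> only contributes a positive scalar, and
  positive scalars will act trivially.\<close>

lemma words_reduced:
  assumes "q \<in> words"
  shows "\<exists>c>0. q = of_real c \<or> (\<exists>s q'. reduced s q' \<and> q = of_real c * q')"
  using assms
proof induction
  case one
  show ?case by (rule exI[of _ 1]) simp
next
  case (step s q)
  then obtain c where c: "c > 0" and q: "q = of_real c \<or> (\<exists>t p. reduced t p \<and> q = of_real c * p)"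
    by blast
  have comm: "s * (of_real c * p) = of_real c * (s * p)" for p
    by (simp add: of_real_def)
  from q show ?case
  proof (elim disjE exE conjE)
    assume "q = of_real c"
    then have "s * q = of_real c * s" by (simp add: of_real_def)
    then show ?thesis using c reduced.letter[OF step(1)] by blast
  next
    fix t p assume t: "reduced t p" "q = of_real c * p"
    show ?thesis
    proof (cases "s = kconj t")
      case False
      then show ?thesis using c comm reduced.step[OF t(1) step(1)] t(2) by metis
    next
      case True
      have tl: "t \<in> letters" using t(1) by (rule reduced_letters)
      have st: "s * t = of_real 5" using letters_mult_kconj[OF step(1)] True by simp
      have c5: "c * 5 > 0" using c by simp
      from t(1) show ?thesis
      proof cases
        case letter
        then have "s * q = of_real (c * 5)" using t(2) comm st by (metis of_real_mult)
        then show ?thesis using c5 by blast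
      next
        case (step r p')
        have "s * q = of_real (c * 5) * p'"
          using t(2) comm st step(1) by (metis mult.assoc of_real_mult)
        then show ?thesis using c5 step by blast
      qed
    qed
  qed
qed

section \<open>Piecewise injections\<close>

lemma equidecomposableI:
  assumes "A \<noteq> {}" "B \<noteq> {}" "\<forall>i<(m::nat). g i \<in> carrier G \<and> P i = \<phi> (g i) ` Q i"
    "disjoint_family_on P {..<m}" "A = (\<Union>i<m. P i)"
    "disjoint_family_on Q {..<m}" "B = (\<Union>i<m. Q i)"
  shows "equidecomposable G \<phi> A B"
  unfolding equidecomposable_def
  by (rule conjI, rule assms(1), rule conjI, rule assms(2), rule exI[of _ m], rule exI[of _ g],
      rule exI[of _ P], rule exI[of _ Q]) (use assms in simp)

context group_action
begin

text \<open>An injective piecewise map is an equidecomposition of \<open>A\<close> with its image;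
  maps are easier to compose and to glue than pairs of partitions.\<close>

definition piecewise :: "'c set \<Rightarrow> ('c \<Rightarrow> 'c) \<Rightarrow> bool" where
  "piecewise A f \<longleftrightarrow> (\<exists>S. finite S \<and> S \<subseteq> carrier G \<and> (\<forall>x\<in>A. \<exists>g\<in>S. f x = \<phi> g x))"

lemma piecewise_comp:
  assumes "piecewise A f" "piecewise B h" "f ` A \<subseteq> B" "A \<subseteq> E"
  shows "piecewise A (h \<circ> f)"
proof -
  interpret group G using group_hom by (rule group_hom.axioms(1))
  from assms(1) obtain S where S: "finite S" "S \<subseteq> carrier G" "\<And>x. x \<in> A \<Longrightarrow> \<exists>g\<in>S. f x = \<phi> g x"
    unfolding piecewise_def by blast
  from assms(2) obtain T where T: "finite T" "T \<subseteq> carrier G" "\<And>x. x \<in> B \<Longrightarrow> \<exists>g\<in>T. h x = \<phi> g x"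
    unfolding piecewise_def by blast
  let ?U = "(\<lambda>(t, s). t \<otimes> s) ` (T \<times> S)"
  have "\<exists>g\<in>?U. (h \<circ> f) x = \<phi> g x" if x: "x \<in> A" for x
  proof -
    obtain s where s: "s \<in> S" "f x = \<phi> s x" using S(3) x by blast
    obtain t where t: "t \<in> T" "h (f x) = \<phi> t (f x)" using T(3) x assms(3) by blast
    have "(h \<circ> f) x = \<phi> (t \<otimes> s) x"
      using s t composition_rule[of x t s] S(2) T(2) x assms(4) by (metis comp_apply subsetD)
    then show ?thesis using s(1) t(1) by force
  qed
  moreover have "finite ?U" "?U \<subseteq> carrier G" using S(1,2) T(1,2) by auto
  ultimately show ?thesis unfolding piecewise_def by blast
qed

lemma equidecomposable_image:
  assumes "piecewise A f" "inj_on f A" "A \<noteq> {}"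
  shows "equidecomposable G \<phi> (f ` A) A"
proof -
  from assms(1) obtain S where S: "finite S" "S \<subseteq> carrier G" "\<And>x. x \<in> A \<Longrightarrow> \<exists>g\<in>S. f x = \<phi> g x"
    unfolding piecewise_def by blast
  from S(1) obtain m g where g: "S = g ` {i. i < (m::nat)}"
    by (auto simp: finite_conv_nat_seg_image)
  \<comment> \<open>Several \<open>g i\<close> may agree with \<open>f\<close> at \<open>x\<close>;
    choosing the least index makes the pieces disjoint.\<close>
  define idx where "idx x = (LEAST i. i < m \<and> f x = \<phi> (g i) x)" for x
  have idx: "idx x < m \<and> f x = \<phi> (g (idx x)) x" if "x \<in> A" for x
  proof -
    have "\<exists>i. i < m \<and> f x = \<phi> (g i) x" using S(3)[OF that] g by auto
    then show ?thesis unfolding idx_def by (rule LeastI_ex)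
  qed
  let ?Q = "\<lambda>i. {x \<in> A. idx x = i}"
  have im: "f ` ?Q i = \<phi> (g i) ` ?Q i" for i
    using idx by (intro image_cong) auto
  have "disjoint_family_on (\<lambda>i. f ` ?Q i) {..<m}"
    using assms(2) by (auto simp: disjoint_family_on_def dest: inj_onD)
  moreover have "disjoint_family_on ?Q {..<m}" by (auto simp: disjoint_family_on_def)
  moreover have "f ` A = (\<Union>i<m. f ` ?Q i)" "A = (\<Union>i<m. ?Q i)" using idx by auto
  moreover have "\<forall>i<m. g i \<in> carrier G \<and> f ` ?Q i = \<phi> (g i) ` ?Q i" using S(2) g im by auto
  moreover have "f ` A \<noteq> {}" using assms(3) by simp
  ultimately show ?thesis using assms(3) by (intro equidecomposableI[where m = m and g = g and P = "\<lambda>i. f ` ?Q i" and Q = ?Q])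
qed

text \<open>Absorption, by induction on \<open>S\<close>: points already treated go through
  \<open>F\<close> and then \<open>f\<close>, and the new points go through \<open>a\<close> and
  then \<open>h\<close>. The disjoint images of \<open>f\<close> and \<open>h\<close> keep the glued
  map injective.\<close>

lemma piecewise_collapse:
  assumes f: "piecewise X f" "inj_on f X" "f ` X \<subseteq> X"
    and h: "piecewise X h" "inj_on h X" "h ` X \<subseteq> X"
    and disj: "f ` X \<inter> h ` X = {}" and X: "X \<subseteq> E"
    and S: "finite S" "S \<subseteq> carrier G"
  shows "\<exists>F. piecewise {x\<in>E. \<exists>g\<in>S. \<phi> g x \<in> X} F \<and> inj_on F {x\<in>E. \<exists>g\<in>S. \<phi> g x \<in> X}
     \<and> F ` {x\<in>E. \<exists>g\<in>S. \<phi> g x \<in> X} \<subseteq> X"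
  using S
proof induction
  case empty
  show ?case by (auto simp: piecewise_def)
next
  case (insert a S)
  let ?A = "{x\<in>E. \<exists>g\<in>S. \<phi> g x \<in> X}" and ?B = "{x\<in>E. \<exists>g\<in>insert a S. \<phi> g x \<in> X}"
  from insert obtain F where F: "piecewise ?A F" "inj_on F ?A" "F ` ?A \<subseteq> X" by auto
  have a: "a \<in> carrier G" using insert by simp
  let ?C = "{x\<in>E. \<phi> a x \<in> X}"
  have pa: "piecewise ?C (\<phi> a)" unfolding piecewise_def using a by (intro exI[of _ "{a}"]) auto
  have fF: "piecewise ?A (f \<circ> F)" by (rule piecewise_comp[OF F(1) f(1) F(3)]) auto
  have ha: "piecewise ?C (h \<circ> \<phi> a)" by (rule piecewise_comp[OF pa h(1)]) auto
  let ?F = "\<lambda>x. if x \<in> ?A then (f \<circ> F) x else (h \<circ> \<phi> a) x"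
  from fF obtain T1 where T1: "finite T1" "T1 \<subseteq> carrier G"
      "\<And>x. x \<in> ?A \<Longrightarrow> \<exists>g\<in>T1. (f \<circ> F) x = \<phi> g x"
    unfolding piecewise_def by blast
  from ha obtain T2 where T2: "finite T2" "T2 \<subseteq> carrier G"
      "\<And>x. x \<in> ?C \<Longrightarrow> \<exists>g\<in>T2. (h \<circ> \<phi> a) x = \<phi> g x"
    unfolding piecewise_def by blast
  have BC: "x \<in> ?C" if "x \<in> ?B" "x \<notin> ?A" for x using that by auto
  have "\<exists>g\<in>T1 \<union> T2. ?F x = \<phi> g x" if "x \<in> ?B" for x
  proof (cases "x \<in> ?A")
    case True
    then show ?thesis using T1(3)[OF True] by auto
  next
    case False
    then show ?thesis using T2(3)[OF BC[OF that False]] by auto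
  qed
  then have 1: "piecewise ?B ?F"
    unfolding piecewise_def using T1(1,2) T2(1,2) by (intro exI[of _ "T1 \<union> T2"]) auto
  have in1: "?F x \<in> f ` X" if "x \<in> ?A" for x
    using that F(3) by auto
  have in2: "?F x \<in> h ` X" if "x \<in> ?B" "x \<notin> ?A" for x
  proof -
    have "?F x = h (\<phi> a x)" using that(2) by auto
    then show ?thesis using BC[OF that] by auto
  qed
  have 2: "inj_on ?F ?B"
  proof (rule inj_onI)
    fix x y assume xy: "x \<in> ?B" "y \<in> ?B" "?F x = ?F y"
    show "x = y"
    proof (cases "x \<in> ?A")
      case True
      then have y: "y \<in> ?A" using in1[OF True] in2[OF xy(2)] xy(3) disj by (metis disjoint_iff)
      have "f (F x) = f (F y)" using xy(3) True y by auto
      then have "F x = F y" using f(2) F(3) True y by (meson image_subset_iff inj_onD)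
      then show ?thesis using F(2) True y by (meson inj_onD)
    next
      case False
      then have y: "y \<notin> ?A" using in2[OF xy(1)] in1[of y] xy(3) disj by (metis disjoint_iff)
      have "h (\<phi> a x) = h (\<phi> a y)" using xy(3) False y by auto
      then have "\<phi> a x = \<phi> a y" using h(2) BC[OF xy(1) False] BC[OF xy(2) y]
        by (auto dest: inj_onD)
      then show ?thesis using inj_prop[OF a] xy by (auto dest: inj_onD)
    qed
  qed
  have 3: "?F ` ?B \<subseteq> X"
  proof
    fix z assume "z \<in> ?F ` ?B"
    then obtain x where "x \<in> ?B" "z = ?F x" by blast
    then show "z \<in> X" using in1[of x] in2[of x] f(3) h(3) by blast
  qed
  show ?case using 1 2 3 by (intro exI[of _ ?F] conjI)
qed

text \<open>After squeezing all of \<open>E\<close> into \<open>X\<close> by an injective piecewise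
  \<open>F\<close>, the maps \<open>f \<circ> F\<close> and \<open>h \<circ> F\<close> produce two
  disjoint copies of \<open>E\<close>.\<close>

lemma paradoxical_of_absorbing:
  assumes f: "piecewise X f" "inj_on f X" "f ` X \<subseteq> X"
    and h: "piecewise X h" "inj_on h X" "h ` X \<subseteq> X"
    and disj: "f ` X \<inter> h ` X = {}" and X: "X \<subseteq> E"
    and S: "finite S" "S \<subseteq> carrier G" "\<And>x. x \<in> E \<Longrightarrow> \<exists>g\<in>S. \<phi> g x \<in> X"
    and E: "E \<noteq> {}"
  shows "paradoxical G \<phi> E"
proof -
  have eq: "{x\<in>E. \<exists>g\<in>S. \<phi> g x \<in> X} = E" using S(3) by auto
  obtain F where F: "piecewise E F" "inj_on F E" "F ` E \<subseteq> X"
    using piecewise_collapse[OF f h disj X S(1,2)] unfolding eq by blast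
  have "equidecomposable G \<phi> ((k \<circ> F) ` E) E" if "piecewise X k" "inj_on k X" for k
    using F that E
    by (intro equidecomposable_image piecewise_comp[OF F(1) that(1) F(3)] comp_inj_on)
      (auto intro: inj_on_subset)
  then have "equidecomposable G \<phi> ((f \<circ> F) ` E) E" "equidecomposable G \<phi> ((h \<circ> F) ` E) E"
    using f h by auto
  moreover have "(f \<circ> F) ` E \<subseteq> f ` X" "(h \<circ> F) ` E \<subseteq> h ` X" using F(3) by auto
  moreover have "(f \<circ> F) ` E \<inter> (h \<circ> F) ` E = {}" using calculation(3,4) disj by blast
  moreover have "(f \<circ> F) ` E \<subseteq> E" "(h \<circ> F) ` E \<subseteq> E"
    using calculation(3,4) f(3) h(3) X by blast+
  ultimately show ?thesis
    unfolding paradoxical_def using E by (intro conjI exI[of _ "(f \<circ> F) ` E"] exI[of _ "(h \<circ> F) ` E"])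
qed

end

section \<open>Projective quaternion actions\<close>

text \<open>Positive scalars act trivially, so integer quaternions act without being normalised and
  \<open>kconj q\<close> acts as the inverse of \<open>q\<close>.\<close>

locale quat_action = group_action G E \<phi> for G (structure) and E and \<phi> +
  fixes \<rho> :: "quat \<Rightarrow> 'a"
  assumes rho_closed: "q \<noteq> 0 \<Longrightarrow> \<rho> q \<in> carrier G"
    and rho_mult: "p \<noteq> 0 \<Longrightarrow> q \<noteq> 0 \<Longrightarrow> \<rho> (p * q) = \<rho> p \<otimes> \<rho> q"
    and rho_pos: "c > 0 \<Longrightarrow> \<rho> (of_real c) = \<one>"
begin

definition act :: "quat \<Rightarrow> 'c \<Rightarrow> 'c" where
  "act q = \<phi> (\<rho> q)"

lemma act_in: "q \<noteq> 0 \<Longrightarrow> x \<in> E \<Longrightarrow> act q x \<in> E"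
  unfolding act_def using element_image rho_closed by blast

lemma act_mult: "p \<noteq> 0 \<Longrightarrow> q \<noteq> 0 \<Longrightarrow> x \<in> E \<Longrightarrow> act (p * q) x = act p (act q x)"
  unfolding act_def by (simp add: rho_mult rho_closed composition_rule)

lemma act_pos: "c > 0 \<Longrightarrow> x \<in> E \<Longrightarrow> act (of_real c) x = x"
  unfolding act_def by (metis rho_pos id_eq_one restrict_apply')

lemma act_kconj: "q \<noteq> 0 \<Longrightarrow> x \<in> E \<Longrightarrow> act (kconj q) (act q x) = x"
  by (subst act_mult[symmetric]) (auto simp: kconj_mult_self act_pos simp del: of_real_power)

text \<open>By \<open>words_reduced\<close> and \<open>reduced_notin_Reals\<close> a real word is a
  positive scalar and acts trivially, so this is the set on which the free group acts
  freely.\<close>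

definition free_part :: "'c set" where
  "free_part = {x \<in> E. \<forall>q\<in>words. act q x = x \<longrightarrow> q \<in> \<real>}"

text \<open>Stabilizers along an orbit are conjugate: if \<open>p\<close> fixes
  \<open>act q x\<close>, then \<open>kconj q * p * q\<close> fixes \<open>x\<close>, hence is real,
  and so is \<open>p\<close>.\<close>

lemma act_free_part:
  assumes q: "q \<in> words" and x: "x \<in> free_part"
  shows "act q x \<in> free_part"
proof -
  have xE: "x \<in> E" using x by (simp add: free_part_def)
  have q0: "q \<noteq> 0" using q by (rule words_nonzero)
  have "p \<in> \<real>" if p: "p \<in> words" "act p (act q x) = act q x" for p
  proof -
    have p0: "p \<noteq> 0" using p(1) by (rule words_nonzero)
    have "act (kconj q * (p * q)) x = x"
      using p0 q0 p(2) xE by (simp add: act_mult act_kconj act_in)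
    then have "kconj q * (p * q) \<in> \<real>"
      using x words_mult[OF kconj_words[OF q] words_mult[OF p(1) q]]
      by (auto simp: free_part_def)
    then obtain r where r: "kconj q * (p * q) = of_real r" by (auto simp: Reals_def)
    \<comment> \<open>Multiplying by \<open>q\<close> and \<open>kconj q\<close> on the outside
      undoes the conjugation up to a real factor.\<close>
    have "of_real ((norm q)\<^sup>2) * p * of_real ((norm q)\<^sup>2) = q * (kconj q * (p * q)) * kconj q"
      by (simp add: mult_kconj_quat[symmetric] mult.assoc del: of_real_power)
    also have "\<dots> = of_real (r * (norm q)\<^sup>2)"
      unfolding r by (simp add: of_real_def mult_kconj_quat)
    finally have "((norm q)\<^sup>2 * (norm q)\<^sup>2) *\<^sub>R p = of_real (r * (norm q)\<^sup>2)"
      by (simp add: of_real_def)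
    moreover have "(norm q)\<^sup>2 * (norm q)\<^sup>2 \<noteq> 0" using q0 by simp
    ultimately have "p = inverse ((norm q)\<^sup>2 * (norm q)\<^sup>2) *\<^sub>R of_real (r * (norm q)\<^sup>2)"
      by (metis scaleR_scaleR left_inverse scaleR_one)
    then show ?thesis by (simp only: scaleR_conv_of_real Reals_mult Reals_of_real)
  qed
  then show ?thesis using act_in[OF q0 xE] by (simp add: free_part_def)
qed

section \<open>Orbit representatives and the pieces of the free part\<close>

definition orbit_rel :: "'c \<Rightarrow> 'c \<Rightarrow> bool" where
  "orbit_rel x y \<longleftrightarrow> (\<exists>q\<in>words. y = act q x)"

text \<open>The choice depends on \<open>x\<close> only through the predicate
  \<open>orbit_rel x\<close>, which is the same for all points of an orbit in \<open>E\<close>; thus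
  one point is chosen per orbit.\<close>

definition rep :: "'c \<Rightarrow> 'c" where
  "rep x = (SOME y. orbit_rel x y)"

lemma orbit_rel_act:
  assumes "q \<in> words" "x \<in> E"
  shows "orbit_rel (act q x) y \<longleftrightarrow> orbit_rel x y"
proof
  assume "orbit_rel x y"
  then obtain p where p: "p \<in> words" "y = act p x" unfolding orbit_rel_def by blast
  have "y = act (p * kconj q) (act q x)"
    using assms p by (simp add: act_mult act_kconj act_in words_nonzero)
  with words_mult[OF p(1) kconj_words[OF assms(1)]] show "orbit_rel (act q x) y"
    unfolding orbit_rel_def by (rule rev_bexI)
next
  assume "orbit_rel (act q x) y"
  then obtain p where p: "p \<in> words" "y = act p (act q x)" unfolding orbit_rel_def by blast
  have "y = act (p * q) x" using assms p by (simp add: act_mult words_nonzero)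
  with words_mult[OF p(1) assms(1)] show "orbit_rel x y"
    unfolding orbit_rel_def by (rule rev_bexI)
qed

lemma rep_act:
  assumes "q \<in> words" "x \<in> E" shows "rep (act q x) = rep x"
proof -
  have "orbit_rel (act q x) = orbit_rel x" using assms by (intro ext orbit_rel_act)
  then show ?thesis by (simp add: rep_def)
qed

lemma orbit_rel_rep:
  assumes "x \<in> E" shows "orbit_rel x (rep x)"
proof -
  have "act 1 x = x" using act_pos[of 1 x] assms by simp
  then have "orbit_rel x x" unfolding orbit_rel_def by (intro bexI[of _ 1]) (auto intro: words.one)
  then show ?thesis unfolding rep_def by (rule someI)
qed

text \<open>
  In the orbit of \<open>rep x\<close> every point is reached by exactly one reduced word (or by \<open>1\<close>);
  \<open>piece s\<close> collects the points whose word starts with \<open>s\<close>.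
\<close>

definition piece :: "quat \<Rightarrow> 'c set" where
  "piece s = {x \<in> free_part. \<exists>q. reduced s q \<and> x = act q (rep x)}"

lemma rep_free_part:
  assumes "x \<in> free_part" shows "rep x \<in> free_part"
proof -
  have "x \<in> E" using assms by (simp add: free_part_def)
  then obtain q where "q \<in> words" "rep x = act q x"
    using orbit_rel_rep unfolding orbit_rel_def by blast
  then show ?thesis using assms by (simp add: act_free_part)
qed

text \<open>Two reduced words with different first letters leading from \<open>rep x\<close> to
  \<open>x\<close> would make \<open>kconj p * q\<close> a non-real word fixing
  \<open>rep x\<close>, a point of the free part.\<close>

lemma piece_disjoint:
  assumes "s \<noteq> t" shows "piece s \<inter> piece t = {}"
proof -
  have False if x: "x \<in> piece s" "x \<in> piece t" for x
  proof -
    from x obtain p q where p: "reduced s p" "x = act p (rep x)" and q: "reduced t q" "x = act q (rep x)"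
      by (auto simp: piece_def)
    have r: "rep x \<in> free_part" using x rep_free_part by (auto simp: piece_def)
    then have rE: "rep x \<in> E" by (simp add: free_part_def)
    have n: "p \<noteq> 0" "q \<noteq> 0" using p(1) q(1) reduced_words words_nonzero by auto
    have "act (kconj p * q) (rep x) = rep x"
      using act_kconj[OF n(1) rE] p(2) q(2) n rE by (simp add: act_mult)
    moreover obtain u where "reduced u (kconj p * q)"
      using reduced_kconj_mult[OF p(1) q(1) assms] by blast
    ultimately show False
      using r reduced_words reduced_notin_Reals by (auto simp: free_part_def)
  qed
  then show ?thesis by blast
qed

text \<open>The reduced word leading to \<open>x\<close> does not begin with \<open>kconj s\<close>,
  so prepending \<open>s\<close> leaves it reduced.\<close>

lemma act_piece:
  assumes s: "s \<in> letters" and x: "x \<in> free_part" "x \<notin> piece (kconj s)"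
  shows "act s x \<in> piece s"
proof -
  have xE: "x \<in> E" using x(1) by (simp add: free_part_def)
  have rE: "rep x \<in> E" using rep_free_part[OF x(1)] by (simp add: free_part_def)
  have s0: "s \<noteq> 0" using s letters_words words_nonzero by blast
  obtain p where p: "p \<in> words" "rep x = act p x"
    using orbit_rel_rep[OF xE] unfolding orbit_rel_def by blast
  \<comment> \<open>The word \<open>p\<close> leads from \<open>x\<close> to \<open>rep x\<close>,
    whereas pieces are defined by words leading back.\<close>
  have xk: "x = act (kconj p) (rep x)"
    using p xE by (simp add: act_kconj words_nonzero)
  have scale: "act (of_real c * q) (rep x) = act q (rep x)" if "c > 0" "q \<noteq> 0" for c q
    using that rE by (simp add: act_mult act_pos act_in)
  obtain c where c: "c > 0" "kconj p = of_real c \<or> (\<exists>t q. reduced t q \<and> kconj p = of_real c * q)"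
    using words_reduced[OF kconj_words[OF p(1)]] by blast
  have "\<exists>q. reduced s q \<and> act s x = act q (rep x)"
    using c(2)
  proof (elim disjE exE conjE)
    assume "kconj p = of_real c"
    then have "x = rep x" using xk c(1) rE by (simp add: act_pos)
    then show ?thesis using reduced.letter[OF s] by metis
  next
    fix t q assume t: "reduced t q" "kconj p = of_real c * q"
    have q0: "q \<noteq> 0" using t(1) reduced_words words_nonzero by blast
    have xq: "x = act q (rep x)" using xk t(2) scale[OF c(1) q0] by simp
    then have "t \<noteq> kconj s" using t(1) x by (auto simp: piece_def)
    then have "reduced s (s * q)" using t(1) s by (intro reduced.step) auto
    moreover have "act s x = act (s * q) (rep x)"
      using xq act_mult[OF s0 q0 rE] by simp
    ultimately show ?thesis by blast
  qed
  moreover have "rep (act s x) = rep x" using s xE by (simp add: rep_act letters_words)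
  moreover have "act s x \<in> free_part" using s x(1) by (simp add: act_free_part letters_words)
  ultimately show ?thesis by (simp add: piece_def)
qed

text \<open>The classical splitting of a free group, read as an injection: points of
  \<open>piece (kconj s)\<close> stay, all others move by \<open>s\<close> into the disjoint set
  \<open>piece s\<close>.\<close>

lemma free_part_injection:
  assumes s: "s \<in> letters"
  shows "\<exists>f. piecewise free_part f \<and> inj_on f free_part \<and> f ` free_part \<subseteq> piece s \<union> piece (kconj s)"
proof -
  interpret group G using group_hom by (rule group_hom.axioms(1))
  let ?f = "\<lambda>x. if x \<in> piece (kconj s) then x else act s x"
  have s0: "s \<noteq> 0" using s letters_words words_nonzero by blast
  have sk: "s \<noteq> kconj s" using s by (auto elim!: letters.cases simp: quat_simps)
  have im: "?f x \<in> piece s" if "x \<in> free_part" "x \<notin> piece (kconj s)" for x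
    using act_piece[OF s that] that by simp
  have "piecewise free_part ?f"
    unfolding piecewise_def act_def
  proof (intro exI[of _ "{\<one>, \<rho> s}"] conjI ballI)
    fix x assume "x \<in> free_part"
    then have "\<phi> \<one> x = x" using id_eq_one by (metis (no_types, lifting) free_part_def mem_Collect_eq restrict_apply')
    then show "\<exists>g\<in>{\<one>, \<rho> s}. (if x \<in> piece (kconj s) then x else \<phi> (\<rho> s) x) = \<phi> g x" by auto
  qed (use rho_closed[OF s0] in auto)
  moreover have "inj_on ?f free_part"
  proof (rule inj_onI)
    fix x y assume xy: "x \<in> free_part" "y \<in> free_part" "?f x = ?f y"
    have inj: "inj_on (act s) E" unfolding act_def using inj_prop rho_closed[OF s0] by blast
    have "x \<in> piece (kconj s) \<longleftrightarrow> y \<in> piece (kconj s)"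
      using im[OF xy(1)] im[OF xy(2)] xy(3) piece_disjoint[OF sk] by (auto split: if_splits)
    then show "x = y" using xy inj by (auto simp: free_part_def split: if_splits dest: inj_onD)
  qed
  moreover have "?f ` free_part \<subseteq> piece s \<union> piece (kconj s)" using im by auto
  ultimately show ?thesis by blast
qed

text \<open>The letters 1 + 2i and 1 + 2j give two injections of the free part into disjoint pairs
  of pieces, and \<open>S\<close> then carries the paradox over to \<open>E\<close>.\<close>

theorem paradoxical_of_free_part:
  assumes S: "finite S" "S \<subseteq> carrier G" "\<And>x. x \<in> E \<Longrightarrow> \<exists>g\<in>S. \<phi> g x \<in> free_part"
    and E: "E \<noteq> {}"
  shows "paradoxical G \<phi> E"
proof -
  let ?a = "Quat 1 2 0 0" and ?b = "Quat 1 0 2 0"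
  obtain f where f: "piecewise free_part f" "inj_on f free_part"
      "f ` free_part \<subseteq> piece ?a \<union> piece (kconj ?a)"
    using free_part_injection[of ?a] letters.intros by blast
  obtain h where h: "piecewise free_part h" "inj_on h free_part"
      "h ` free_part \<subseteq> piece ?b \<union> piece (kconj ?b)"
    using free_part_injection[of ?b] letters.intros by blast
  have sub: "piece s \<subseteq> free_part" for s by (auto simp: piece_def)
  have "piece s \<inter> piece t = {}" if "s \<in> {?a, kconj ?a}" "t \<in> {?b, kconj ?b}" for s t
    using that by (intro piece_disjoint) (auto simp: quat_simps)
  then have "(piece ?a \<union> piece (kconj ?a)) \<inter> (piece ?b \<union> piece (kconj ?b)) = {}" by blast
  then have "f ` free_part \<inter> h ` free_part = {}" using f(3) h(3) by blast
  moreover have "f ` free_part \<subseteq> free_part" "h ` free_part \<subseteq> free_part"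
    using f(3) h(3) sub by blast+
  moreover have "free_part \<subseteq> E" by (auto simp: free_part_def)
  ultimately show ?thesis
    using paradoxical_of_absorbing[OF f(1,2) _ h(1,2) _ _ _ S E] by blast
qed

end

section \<open>Coordinate subspaces and flags\<close>

definition coord_space :: "'n set \<Rightarrow> (('a::conj_div_algebra)^'n) set" where
  "coord_space A = {x. \<forall>i. i \<notin> A \<longrightarrow> x $ i = 0}"

lemma right_subspace_coord_space: "right_subspace (coord_space A)"
  by (auto simp: right_subspace_def coord_space_def rscale_def)

lemma sum_rscale_axis:
  "(\<Sum>i\<in>A. rscale (axis i 1) (c i)) = (\<chi> i. if i \<in> A then c i else (0::'a::conj_div_algebra))"
  for A :: "'n::finite set"
proof -
  have "(\<Sum>i\<in>A. rscale (axis i 1) (c i) $ j) = (\<Sum>i\<in>A. if i = j then c i else 0)" for j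
    by (intro sum.cong) (auto simp: rscale_def axis_def)
  then show ?thesis by (simp add: vec_eq_iff)
qed

lemma inj_axis_1: "inj (\<lambda>i. axis i (1::'a::zero_neq_one))"
  by (auto simp: inj_on_def axis_eq_axis)

lemma right_basis_coord_space:
  "right_basis ((\<lambda>i. axis i (1::'a)) ` A) (coord_space A :: ('a::conj_div_algebra^'n) set)"
proof -
  let ?B = "(\<lambda>i. axis i (1::'a)) ` A"
  have eq: "(\<Sum>b\<in>?B. rscale b (c b)) = (\<chi> i. if i \<in> A then c (axis i (1::'a)) else 0)" for c
    using sum_rscale_axis[of "\<lambda>i. c (axis i (1::'a))" A]
    by (simp add: sum.reindex[OF inj_on_subset[OF inj_axis_1]])
  show ?thesis
    unfolding right_basis_def eq
  proof (intro conjI allI impI)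
    show "(coord_space A :: ('a^'n) set) = {\<chi> i. if i \<in> A then c (axis i (1::'a)) else 0 |c. True}"
    proof (intro equalityI subsetI)
      fix x :: "'a^'n" assume x: "x \<in> coord_space A"
      have "inv_into UNIV (\<lambda>i. axis i (1::'a)) (axis j 1) = j" for j :: 'n
        by (rule inv_f_f[OF inj_axis_1])
      moreover define c where "c b = x $ inv_into UNIV (\<lambda>i. axis i (1::'a)) b" for b :: "'a^'n"
      ultimately have "x = (\<chi> i. if i \<in> A then c (axis i (1::'a)) else 0)"
        using x by (auto simp: vec_eq_iff coord_space_def)
      then show "x \<in> {\<chi> i. if i \<in> A then c (axis i (1::'a)) else 0 |c. True}" by blast
    qed (auto simp: coord_space_def)
  next
    fix c :: "'a^'n \<Rightarrow> 'a" assume c: "(\<chi> i. if i \<in> A then c (axis i (1::'a)) else 0) = 0"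
    have "c (axis i 1) = 0" if "i \<in> A" for i
      using arg_cong[OF c, of "\<lambda>x. x $ i"] that by simp
    then show "\<forall>b\<in>?B. c b = 0" by blast
  qed simp
qed

lemma has_right_dim_coord_space:
  "has_right_dim (coord_space A :: ('a::conj_div_algebra^'n) set) (card A)"
  unfolding has_right_dim_def
  using right_basis_coord_space[of A] card_image[OF inj_on_subset[OF inj_axis_1 subset_UNIV], of A]
  by blast

lemma coord_space_strict_mono:
  assumes "A \<subset> B"
  shows "coord_space A \<subset> (coord_space B :: ('a::conj_div_algebra^'n) set)"
proof -
  obtain i where i: "i \<in> B" "i \<notin> A" using assms by blast
  have "axis i 1 \<in> (coord_space B :: ('a^'n) set)" "axis i 1 \<notin> (coord_space A :: ('a^'n) set)"
    using i by (auto simp: coord_space_def axis_def)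
  moreover have "coord_space A \<subseteq> (coord_space B :: ('a^'n) set)"
    using assms by (auto simp: coord_space_def)
  ultimately show ?thesis by blast
qed

text \<open>The witness is the standard coordinate flag along an enumeration \<open>e\<close> of the
  index type.\<close>

lemma flag_manifold_nonempty:
  assumes "ds \<noteq> []" "0 < hd ds" "sorted_wrt (<) ds" "last ds = CARD('n::finite)"
  shows "flag_manifold ds \<noteq> ({} :: ('a::conj_div_algebra^'n) set list set)"
proof -
  obtain e where e: "bij_betw e {0..<CARD('n)} (UNIV :: 'n set)"
    using ex_bij_betw_nat_finite[of "UNIV :: 'n set"] by auto
  let ?V = "\<lambda>d. coord_space (e ` {0..<d}) :: ('a^'n) set"
  \<comment> \<open>The additional 0 yields the zero space at the start and accounts for the index
    shift between dimensions and subspaces.\<close>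
  let ?Vs = "map ?V (0 # ds)"
  have inj: "inj_on e {0..<d}" if "d \<le> CARD('n)" for d
    using e that by (auto simp: bij_betw_def intro: inj_on_subset)
  have le: "ds ! i \<le> CARD('n)" if "i < length ds" for i
  proof -
    have "ds ! i \<le> ds ! (length ds - 1)"
    proof (cases "i = length ds - 1")
      case False
      then show ?thesis
        using that sorted_wrt_nth_less[OF assms(3), of i "length ds - 1"] by linarith
    qed simp
    then show ?thesis using assms(1,4) by (simp add: last_conv_nth)
  qed
  have lt: "(0 # ds) ! i < ds ! i" if "i < length ds" for i
  proof (cases i)
    case 0
    then show ?thesis using assms(1,2) by (simp add: hd_conv_nth)
  next
    case (Suc j)
    then show ?thesis using sorted_wrt_nth_less[OF assms(3), of j i] that by simp
  qed
  have card: "has_right_dim (?V d) d" if "d \<le> CARD('n)" for d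
    using has_right_dim_coord_space[of "e ` {0..<d}"] card_image[OF inj[OF that]] by simp
  have strict: "?V c \<subset> ?V d" if "c < d" "d \<le> CARD('n)" for c d
  proof (rule coord_space_strict_mono)
    have "e c \<notin> e ` {0..<c}"
    proof
      assume "e c \<in> e ` {0..<c}"
      then obtain y where "e c = e y" "y < c" by auto
      then show False using inj_onD[OF inj[OF that(2)], of c y] that by auto
    qed
    moreover have "e c \<in> e ` {0..<d}" using that by auto
    ultimately show "e ` {0..<c} \<subset> e ` {0..<d}" using that by auto
  qed
  have Vs: "?Vs ! i = ?V ((0 # ds) ! i)" if "i \<le> length ds" for i
    using that by (intro nth_map) simp
  have "?V ((0 # ds) ! length ds) = UNIV"
  proof -
    have "(0 # ds) ! length ds = CARD('n)"
      using assms(1,4) by (simp add: last_conv_nth nth_Cons')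
    then show ?thesis using e by (simp add: bij_betw_def coord_space_def)
  qed
  then have "?Vs ! length ds = UNIV" using Vs by simp
  moreover have "\<forall>V\<in>set ?Vs. right_subspace V" using right_subspace_coord_space by auto
  moreover have "?Vs ! 0 = {0}" by (auto simp: coord_space_def vec_eq_iff)
  moreover have "?Vs ! i \<subset> ?Vs ! Suc i" "has_right_dim (?Vs ! Suc i) (ds ! i)"
    if "i < length ds" for i
    using Vs[of i] Vs[of "Suc i"] strict[OF lt[OF that] le[OF that]] card[OF le[OF that]] that
    by simp_all
  ultimately have "?Vs \<in> flag_manifold ds"
    unfolding flag_manifold_def by simp
  then show ?thesis by blast
qed

lemma flag_action_apply: "Vs \<in> flag_manifold ds \<Longrightarrow> flag_action ds g Vs = map (image g) Vs"
  by (simp add: flag_action_def)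

section \<open>Closure properties of right subspaces and a criterion for triviality\<close>

lemma right_subspace_scaleR:
  "right_subspace V \<Longrightarrow> x \<in> V \<Longrightarrow> c *\<^sub>R x \<in> V"
proof -
  assume V: "right_subspace V" "x \<in> V"
  have "rscale x (of_real c) = c *\<^sub>R x" by (simp add: vec_eq_iff rscale_def of_real_def)
  then show ?thesis using V unfolding right_subspace_def by metis
qed

lemma right_subspace_diff:
  "right_subspace V \<Longrightarrow> x \<in> V \<Longrightarrow> y \<in> V \<Longrightarrow> x - y \<in> V"
  using right_subspace_scaleR[of V y "-1"] unfolding right_subspace_def
  by (metis scaleR_minus1_left uminus_add_conv_diff add.commute)

lemma right_subspace_sum:
  "right_subspace V \<Longrightarrow> (\<And>i. i \<in> A \<Longrightarrow> f i \<in> V) \<Longrightarrow> (\<Sum>i\<in>A. f i) \<in> V"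
  by (induction A rule: infinite_finite_induct) (auto simp: right_subspace_def)

lemma right_subspace_eq_UNIV:
  assumes V: "right_subspace V" "\<And>i. axis i 1 \<in> V"
  shows "V = (UNIV :: ('a::conj_div_algebra^'n) set)"
proof -
  have "x \<in> V" for x
  proof -
    have eq: "x = (\<Sum>i\<in>UNIV. rscale (axis i 1) (x $ i))"
      by (subst sum_rscale_axis) (simp add: vec_eq_iff)
    moreover have "rscale (axis i 1) (x $ i) \<in> V" for i
      using V unfolding right_subspace_def by blast
    ultimately have "(\<Sum>i\<in>UNIV. rscale (axis i 1) (x $ i)) \<in> V"
      by (intro right_subspace_sum[OF V(1)])
    with eq show ?thesis by (rule ssubst)
  qed
  then show ?thesis by blast
qed

text \<open>One nonzero coordinate \<open>a\<close> of one vector already forces every axis into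
  \<open>V\<close>, as \<open>b\<close> is arbitrary. The bound on the dimension provides some index
  other than \<open>a\<close>, through which \<open>step\<close> also yields the axis of
  \<open>a\<close>.\<close>

lemma right_subspace_trivialI:
  fixes V :: "('a::conj_div_algebra^'n) set"
  assumes V: "right_subspace V" and "CARD('n) \<ge> 2"
    and step: "\<And>x a b. x \<in> V \<Longrightarrow> x $ a \<noteq> 0 \<Longrightarrow> a \<noteq> b \<Longrightarrow> axis a 1 \<in> V \<and> axis b 1 \<in> V"
  shows "V = {0} \<or> V = UNIV"
proof (cases "V = {0}")
  case False
  have "0 \<in> V" using V by (simp add: right_subspace_def)
  then obtain x where "x \<in> V" "x \<noteq> 0" using False by blast
  then obtain a where x: "x \<in> V" "x $ a \<noteq> 0" by (auto simp: vec_eq_iff)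
  have "(UNIV :: 'n set) \<noteq> {a}" using assms(2) by (metis One_nat_def card.empty card.insert
        empty_iff finite.emptyI numeral_2_eq_2 not_less_eq_eq order_refl)
  then obtain c where "a \<noteq> c" by (metis UNIV_eq_I singleton_iff)
  have "axis b 1 \<in> V" for b
    using step[OF x] \<open>a \<noteq> c\<close> by (cases "a = b") auto
  then show ?thesis using right_subspace_eq_UNIV[OF V] by blast
qed simp

section \<open>Isometries\<close>

lemma isometryI:
  assumes "right_linear g" "\<And>x. norm (g x) = norm x" "\<And>y. \<exists>x. g x = y"
  shows "g \<in> carrier isometry_group"
proof -
  have diff: "g (x - y) = g x - g y" for x y
    using assms(1) unfolding right_linear_def by (metis add_diff_cancel diff_add_cancel)
  have "inj g"
  proof (rule injI)
    fix x y assume "g x = g y"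
    then have "norm (x - y) = 0" using assms(2)[of "x - y"] diff by simp
    then show "x = y" by simp
  qed
  moreover have "surj g" using assms(3) by (metis surjI)
  ultimately show ?thesis
    using assms(1,2) diff by (simp add: isometry_group_def bij_def kdist_eq_dist dist_norm[of "g _"]
        flip: diff) (simp add: dist_norm)
qed

lemma isometry_inj: "g \<in> carrier isometry_group \<Longrightarrow> inj g"
  by (simp add: isometry_group_def bij_is_inj)

lemma isometry_right_subspace_image:
  assumes "g \<in> carrier isometry_group" "right_subspace V"
  shows "right_subspace (g ` V)"
proof -
  have l: "right_linear g" using assms(1) by (simp add: isometry_group_def)
  show ?thesis
    unfolding right_subspace_def
  proof (intro conjI ballI allI)
    show "0 \<in> g ` V"
      using assms(2) right_linear_0[OF l] unfolding right_subspace_def by (metis image_eqI)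
  next
    fix x y assume "x \<in> g ` V" "y \<in> g ` V"
    then obtain u v where "x = g u" "y = g v" "u \<in> V" "v \<in> V" by blast
    then have "x + y = g (u + v)" "u + v \<in> V"
      using assms(2) l by (auto simp: right_subspace_def right_linear_def)
    then show "x + y \<in> g ` V" by blast
  next
    fix x c assume "x \<in> g ` V"
    then obtain u where "x = g u" "u \<in> V" by blast
    then have "rscale x c = g (rscale u c)" "rscale u c \<in> V"
      using assms(2) l by (auto simp: right_subspace_def right_linear_def)
    then show "rscale x c \<in> g ` V" by blast
  qed
qed

definition permute :: "('n \<Rightarrow> 'n) \<Rightarrow> ('a::conj_div_algebra)^'n \<Rightarrow> 'a^'n" where
  "permute \<sigma> x = (\<chi> i. x $ \<sigma> i)"

lemma norm_vec_power2: "(norm x)\<^sup>2 = (\<Sum>i\<in>UNIV. (norm (x $ i))\<^sup>2)"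
  unfolding norm_vec_def L2_set_def by (intro real_sqrt_pow2 sum_nonneg zero_le_power2)

lemma permute_isometry:
  assumes "bij \<sigma>" shows "permute \<sigma> \<in> carrier isometry_group"
proof (rule isometryI)
  show "right_linear (permute \<sigma>)"
    by (simp add: right_linear_def permute_def rscale_def vec_eq_iff)
  show "norm (permute \<sigma> x) = norm x" for x
  proof -
    have "(norm (permute \<sigma> x))\<^sup>2 = (norm x)\<^sup>2"
      unfolding norm_vec_power2 permute_def
      using sum.reindex_bij_betw[OF assms, of "\<lambda>i. (norm (x $ i))\<^sup>2"] by simp
    then show ?thesis by simp
  qed
  show "\<exists>x. permute \<sigma> x = y" for y
    by (rule exI[of _ "permute (inv_into UNIV \<sigma>) y"])
      (simp add: permute_def vec_eq_iff inv_f_f[OF bij_is_inj[OF assms]])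
qed

lemma permute_axis: "bij \<sigma> \<Longrightarrow> permute \<sigma> (axis (\<sigma> i) c) = axis i c"
  by (auto simp: permute_def axis_def vec_eq_iff bij_def inj_eq)

text \<open>Brings any two coordinates into the fixed block on which quaternions act.\<close>

lemma obtain_permutation:
  fixes i j a b :: 'n
  assumes "i \<noteq> j" "a \<noteq> b"
  obtains \<sigma> where "bij \<sigma>" "\<sigma> i = a" "\<sigma> j = b"
proof
  let ?s = "Transposition.transpose i a"
  \<comment> \<open>The inner transposition sends \<open>j\<close> to \<open>?s b\<close>, which
    \<open>?s\<close> returns to \<open>b\<close>; it leaves \<open>i\<close> alone, because
    \<open>?s b\<close> differs from \<open>i\<close>.\<close>
  let ?t = "?s \<circ> Transposition.transpose j (?s b)"
  show "bij ?t" by (intro bij_comp) auto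
  show "?t j = b" by simp
  have "?s b \<noteq> i" using assms by (auto simp: transpose_eq_iff)
  then show "?t i = a" using assms(1) by (simp add: transpose_apply_other)
qed

section \<open>Quaternions acting on a block of coordinates\<close>

definition imag :: "quat \<Rightarrow> quat" where
  "imag q = Quat 0 (qi q) (qj q) (qk q)"

text \<open>
  \<open>pack\<close> reads a block of coordinates as a quaternion in \<open>B\<close>, \<open>upd\<close> writes it back, \<open>L u\<close> is
  the action of the unit quaternion \<open>u / \<bar>u\<bar>\<close> on blocks and \<open>D\<close> its derivative at \<open>1\<close>.
\<close>

locale block_action =
  fixes pack :: "('a::conj_div_algebra)^'n \<Rightarrow> quat" and upd :: "'a^'n \<Rightarrow> quat \<Rightarrow> 'a^'n"
    and B :: "quat set" and L D :: "quat \<Rightarrow> quat \<Rightarrow> quat"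
  assumes pack_in: "pack x \<in> B"
    and pack_upd: "q \<in> B \<Longrightarrow> pack (upd x q) = q"
    and upd_upd: "upd (upd x p) q = upd x q"
    and upd_pack: "upd x (pack x) = x"
    and upd_add: "upd (x + y) (p + q) = upd x p + upd y q"
    and upd_scaleR: "upd (c *\<^sub>R x) (c *\<^sub>R p) = c *\<^sub>R upd x p"
    and pack_add: "pack (x + y) = pack x + pack y"
    and norm_upd: "q \<in> B \<Longrightarrow> norm q = norm (pack x) \<Longrightarrow> norm (upd x q) = norm x"
    and L_in: "u \<noteq> 0 \<Longrightarrow> q \<in> B \<Longrightarrow> L u q \<in> B"
    and L_norm: "u \<noteq> 0 \<Longrightarrow> norm (L u q) = norm q"
    and L_mult: "L (u * v) q = L u (L v q)"
    and L_pos: "c > 0 \<Longrightarrow> q \<in> B \<Longrightarrow> L (of_real c) q = q"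
    and L_add: "L u (p + q) = L u p + L u q"
    and L_rscale: "upd (rscale x k) (L u (pack (rscale x k))) = rscale (upd x (L u (pack x))) k"
    and L_diff: "qre u \<noteq> 0 \<Longrightarrow> \<exists>c. c \<noteq> 0 \<and> (\<forall>q. L u q - L (kconj u) q = c *\<^sub>R D (imag u) q)"
begin

definition \<rho> :: "quat \<Rightarrow> 'a^'n \<Rightarrow> 'a^'n" where
  "\<rho> u x = upd x (L u (pack x))"

text \<open>The base vector is 0 because \<open>\<rho> u\<close> is the identity outside the block,
  where its derivative therefore vanishes.\<close>

definition T :: "quat \<Rightarrow> 'a^'n \<Rightarrow> 'a^'n" where
  "T w x = upd 0 (D w (pack x))"

lemma upd_diff: "upd (x - y) (p - q) = upd x p - upd y q"
  using upd_add[of x "(-1) *\<^sub>R y" p "(-1) *\<^sub>R q"] upd_scaleR[of "-1" y q] by simp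

lemma upd_0_add: "upd 0 (p + q) = upd 0 p + upd 0 q"
  using upd_add[of 0 0] by simp

lemma upd_0_scaleR: "upd 0 (c *\<^sub>R p) = c *\<^sub>R upd 0 p"
  using upd_scaleR[of c 0] by simp

lemma rho_comp: "u \<noteq> 0 \<Longrightarrow> v \<noteq> 0 \<Longrightarrow> \<rho> (u * v) x = \<rho> u (\<rho> v x)"
  by (simp add: \<rho>_def pack_upd L_in pack_in upd_upd L_mult)

lemma rho_positive: "c > 0 \<Longrightarrow> \<rho> (of_real c) x = x"
  by (simp add: \<rho>_def L_pos pack_in upd_pack)

lemma rho_kconj: "u \<noteq> 0 \<Longrightarrow> \<rho> (kconj u) (\<rho> u x) = x"
  using rho_comp[of "kconj u" u x] rho_positive[of "(norm u)\<^sup>2" x]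
  by (simp add: kconj_mult_self del: of_real_power)

lemma rho_isometry:
  assumes "u \<noteq> 0" shows "\<rho> u \<in> carrier isometry_group"
proof (rule isometryI)
  show "right_linear (\<rho> u)"
    by (simp add: right_linear_def \<rho>_def pack_add L_add upd_add L_rscale)
  show "norm (\<rho> u x) = norm x" for x
    using assms by (simp add: \<rho>_def norm_upd L_in L_norm pack_in)
  show "\<exists>x. \<rho> u x = y" for y
    using rho_kconj[of "kconj u" y] assms by auto
qed

lemma rho_diff:
  assumes "qre u \<noteq> 0"
  shows "\<exists>c. c \<noteq> 0 \<and> (\<forall>x. \<rho> u x - \<rho> (kconj u) x = c *\<^sub>R T (imag u) x)"
proof -
  obtain c where c: "c \<noteq> 0" "\<And>q. L u q - L (kconj u) q = c *\<^sub>R D (imag u) q"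
    using L_diff[OF assms] by blast
  have "\<rho> u x - \<rho> (kconj u) x = c *\<^sub>R T (imag u) x" for x
    using upd_diff[of x x "L u (pack x)" "L (kconj u) (pack x)"] upd_scaleR[of c 0]
    by (simp add: \<rho>_def T_def c(2))
  then show ?thesis using c(1) by blast
qed

text \<open>The inverse \<open>\<rho> (kconj u)\<close> preserves \<open>V\<close> too, hence so
  does the difference, a nonzero multiple of \<open>T (imag u)\<close>. A single group element thus
  gives an infinitesimal one without any limit.\<close>

lemma stable_T:
  assumes u: "qre u \<noteq> 0" and V: "right_subspace V" and fixV: "\<rho> u ` V = V" and x: "x \<in> V"
  shows "T (imag u) x \<in> V"
proof -
  have u0: "u \<noteq> 0" using u by auto
  obtain c where c: "c \<noteq> 0" "\<And>x. \<rho> u x - \<rho> (kconj u) x = c *\<^sub>R T (imag u) x"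
    using rho_diff[OF u] by blast
  obtain y where y: "y \<in> V" "x = \<rho> u y" using x fixV by blast
  have "\<rho> (kconj u) x \<in> V" using y by (simp add: rho_kconj[OF u0])
  moreover have "\<rho> u x \<in> V" using x fixV by blast
  ultimately have "c *\<^sub>R T (imag u) x \<in> V"
    using right_subspace_diff[OF V] by (metis c(2))
  then have "inverse c *\<^sub>R (c *\<^sub>R T (imag u) x) \<in> V" by (rule right_subspace_scaleR[OF V])
  then show ?thesis using c(1) by simp
qed

lemma quat_action_flag: "quat_action isometry_group (flag_manifold ds) (flag_action ds) \<rho>"
proof -
  interpret group_action isometry_group "flag_manifold ds" "flag_action ds"
    by (rule group_action_flag_action)
  show ?thesis
  proof
    show "q \<noteq> 0 \<Longrightarrow> \<rho> q \<in> carrier isometry_group" for q by (rule rho_isometry)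
    show "\<rho> (p * q) = \<rho> p \<otimes>\<^bsub>isometry_group\<^esub> \<rho> q" if "p \<noteq> 0" "q \<noteq> 0" for p q
      using rho_comp[OF that] by (auto simp: isometry_group_def)
    show "\<rho> (of_real c) = \<one>\<^bsub>isometry_group\<^esub>" if "c > 0" for c
      using rho_positive[OF that] by (auto simp: isometry_group_def)
  qed
qed

text \<open>With at least two entries in \<open>ds\<close>, the entry \<open>Vs ! 1\<close> is a
  nonzero proper subspace. By \<open>key\<close> some \<open>g\<close> in \<open>S\<close> moves it
  to one fixed by no non-real word, and \<open>g\<close> then moves the flag into the free
  part.\<close>

lemma paradoxical_flag_manifold:
  assumes ds: "length ds \<ge> 2" "0 < hd ds" "sorted_wrt (<) ds" "last ds = CARD('n)"
    and S: "finite S" "S \<subseteq> carrier isometry_group"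
    and key: "\<And>V. right_subspace V \<Longrightarrow>
       \<forall>g\<in>S. \<exists>u\<in>words. u \<notin> \<real> \<and> \<rho> u ` g ` V = g ` V \<Longrightarrow> V = {0} \<or> V = UNIV"
  shows "paradoxical (isometry_group :: ('a^'n \<Rightarrow> 'a^'n) monoid) (flag_action ds) (flag_manifold ds)"
proof -
  interpret quat_action isometry_group "flag_manifold ds" "flag_action ds" \<rho>
    by (rule quat_action_flag)
  show ?thesis
  proof (rule paradoxical_of_free_part[OF S])
    show "flag_manifold ds \<noteq> ({} :: ('a^'n) set list set)"
      using ds by (intro flag_manifold_nonempty) auto
    fix Vs :: "('a^'n) set list" assume Vs: "Vs \<in> flag_manifold ds"
    let ?V = "Vs ! 1"
    have len: "length Vs = Suc (length ds)" using Vs by (simp add: flag_manifold_def)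
    have "1 < length Vs" using len ds(1) by linarith
    then have V1: "?V \<in> set Vs" by (rule nth_mem)
    then have V: "right_subspace ?V" using Vs by (simp add: flag_manifold_def)
    have "Vs ! i \<subset> Vs ! Suc i" if "i < length ds" for i
      using Vs that by (simp add: flag_manifold_def)
    note inc = this
    have "0 < length ds" "1 < length ds" using ds(1) by linarith+
    from inc[OF this(1)] inc[OF this(2)] have "Vs ! 0 \<subset> Vs ! 1" "Vs ! 1 \<subset> Vs ! Suc 1"
      by simp_all
    moreover have "Vs ! 0 = {0}" using Vs by (simp add: flag_manifold_def)
    ultimately have "?V \<noteq> {0}" "?V \<noteq> UNIV" by auto
    then obtain g where g: "g \<in> S" and u: "\<And>u. u \<in> words \<Longrightarrow> u \<notin> \<real> \<Longrightarrow> \<rho> u ` g ` ?V \<noteq> g ` ?V"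
      using key[OF V] by blast
    have gc: "g \<in> carrier isometry_group" using g S(2) by blast
    have in_F: "map (image g) Vs \<in> flag_manifold ds" using flag_image[OF gc Vs] .
    have "u \<in> \<real>" if "u \<in> words" "act u (map (image g) Vs) = map (image g) Vs" for u
    proof (rule ccontr)
      assume "u \<notin> \<real>"
      have "\<forall>x\<in>set Vs. \<rho> u ` g ` x = g ` x"
        using that(2) by (simp add: act_def flag_action_apply[OF in_F])
      then show False using u[OF that(1) \<open>u \<notin> \<real>\<close>] V1 by blast
    qed
    then have "map (image g) Vs \<in> free_part" using in_F by (simp add: free_part_def)
    then show "\<exists>g\<in>S. flag_action ds g Vs \<in> free_part"
      using g flag_action_apply[OF Vs] by metis
  qed
qed

end

section \<open>Real Lie algebras of imaginary quaternions\<close>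

text \<open>Irrationality of the square root of 3: the exponent of 3 is even in m^2 and odd in
  3n^2.\<close>

lemma sqrt_3_Ints:
  assumes "a \<in> \<int>" "b \<in> \<int>" "a = sqrt 3 * b"
  shows "a = 0" "b = 0"
proof -
  obtain m n :: int where mn: "a = of_int m" "b = of_int n"
    using assms(1,2) by (auto elim!: Ints_cases)
  have "a\<^sup>2 = 3 * b\<^sup>2" using assms(3) by (simp add: power_mult_distrib)
  then have "of_int (m\<^sup>2) = (of_int (3 * n\<^sup>2) :: real)" using mn by simp
  then have eq: "m\<^sup>2 = 3 * n\<^sup>2" by (simp only: of_int_eq_iff)
  have "n = 0"
  proof (rule ccontr)
    assume n: "n \<noteq> 0"
    then have m: "m \<noteq> 0" using eq by auto
    have p: "prime_elem (3::int)" by simp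
    have "2 * multiplicity 3 m = multiplicity 3 (m\<^sup>2)"
      using m p by (simp add: prime_elem_multiplicity_power_distrib)
    also have "\<dots> = 1 + 2 * multiplicity 3 n"
      using n p unfolding eq
      by (simp add: prime_elem_multiplicity_power_distrib prime_elem_multiplicity_mult_distrib)
    finally show False by presburger
  qed
  then show "b = 0" "a = 0" using assms(3) mn by simp_all
qed

text \<open>Up to the factor 2, the commutator of imaginary quaternions is the cross product of
  \<real>^3.\<close>

locale imaginary_lie_algebra =
  fixes H :: "quat set"
  assumes H_add: "p \<in> H \<Longrightarrow> q \<in> H \<Longrightarrow> p + q \<in> H"
    and H_scaleR: "p \<in> H \<Longrightarrow> c *\<^sub>R p \<in> H"
    and H_commutator: "p \<in> H \<Longrightarrow> q \<in> H \<Longrightarrow> p * q - q * p \<in> H"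
    and H_imag: "p \<in> H \<Longrightarrow> qre p = 0"
begin

lemma H_diff: "p \<in> H \<Longrightarrow> q \<in> H \<Longrightarrow> p - q \<in> H"
  using H_add[of p "(-1) *\<^sub>R q"] H_scaleR[of q "-1"] by simp

text \<open>Two expansions of triple cross products express \<open>e\<close> through
  \<open>p\<close>, \<open>q\<close> and their commutator \<open>c\<close>, which is
  nonzero.\<close>

lemma all_imaginary:
  assumes p: "p \<in> H" and q: "q \<in> H" and ne: "p * q \<noteq> q * p" and e: "qre e = 0"
  shows "e \<in> H"
proof -
  define c where "c = p * q - q * p"
  \<comment> \<open>This is the commutator of \<open>c\<close> and \<open>e\<close>, expanded by the
    triple product formula; the expansion shows membership in \<open>H\<close> without knowing it
    for \<open>e\<close>.\<close>
  define m where "m = (4 * (qi p * qi e + qj p * qj e + qk p * qk e)) *\<^sub>R q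
    - (4 * (qi q * qi e + qj q * qj e + qk q * qk e)) *\<^sub>R p"
  define N where "N = (qi c)\<^sup>2 + (qj c)\<^sup>2 + (qk c)\<^sup>2"
  have c: "c \<in> H" unfolding c_def by (rule H_commutator[OF p q])
  have re: "qre p = 0" "qre q = 0" "qre c = 0" using H_imag p q c by auto
  have m: "m \<in> H" unfolding m_def by (intro H_diff H_scaleR p q)
  have mc: "m = c * e - e * c"
    using re e unfolding m_def c_def by (simp add: quat_eq_iff times_quat_def) (auto simp: algebra_simps)
  have "(4 * N) *\<^sub>R e = (4 * (qi c * qi e + qj c * qj e + qk c * qk e)) *\<^sub>R c - (c * m - m * c)"
    using re e unfolding mc N_def
    by (simp add: quat_eq_iff times_quat_def power2_eq_square) (auto simp: algebra_simps)
  moreover have "(4 * (qi c * qi e + qj c * qj e + qk c * qk e)) *\<^sub>R c - (c * m - m * c) \<in> H"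
    by (intro H_diff H_scaleR H_commutator c m)
  ultimately have "inverse (4 * N) *\<^sub>R ((4 * N) *\<^sub>R e) \<in> H" using H_scaleR by metis
  moreover have "N \<noteq> 0"
  proof
    assume "N = 0"
    then have "qi c = 0" "qj c = 0" "qk c = 0"
      unfolding N_def by (smt (verit) zero_le_power2 power_eq_0_iff)+
    then have "c = 0" using re by (simp add: quat_eq_iff)
    then show False using ne by (simp add: c_def)
  qed
  ultimately show ?thesis by simp
qed

text \<open>
  Otherwise \<open>H\<close> would be commutative, hence a single line, namely the rational line through
  \<open>imag v\<^sub>0\<close>. But a rotation by \<open>60\<close> degrees moves every rational line except its axis to an
  irrational one, so one of two rotations with different axes contradicts this.
\<close>

lemma all_imaginary_of_int:
  assumes v: "v\<^sub>0 \<in> quat_int" "v\<^sub>1 \<in> quat_int" "v\<^sub>2 \<in> quat_int"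
    and nr: "v\<^sub>0 \<notin> \<real>" "v\<^sub>1 \<notin> \<real>" "v\<^sub>2 \<notin> \<real>"
    and H0: "imag v\<^sub>0 \<in> H"
    and H1: "imag (kconj (Quat (sqrt 3) 0 0 1) * v\<^sub>1 * Quat (sqrt 3) 0 0 1) \<in> H"
    and H2: "imag (kconj (Quat (sqrt 3) 1 0 0) * v\<^sub>2 * Quat (sqrt 3) 1 0 0) \<in> H"
    and e: "qre e = 0"
  shows "e \<in> H"
proof (rule ccontr)
  assume "e \<notin> H"
  then have comm: "p * q = q * p" if "p \<in> H" "q \<in> H" for p q
    using all_imaginary[OF that _ e] by blast
  obtain x y z where v0: "imag v\<^sub>0 = Quat 0 x y z" and i0: "x \<in> \<int>" "y \<in> \<int>" "z \<in> \<int>"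
    using v(1) by (auto simp: quat_int_def imag_def)
  have n0: "x \<noteq> 0 \<or> y \<noteq> 0 \<or> z \<noteq> 0" using nr(1) v0 by (auto simp: quat_Reals_iff imag_def)
  define a b c where "a = qi v\<^sub>1" and "b = qj v\<^sub>1" and "c = qk v\<^sub>1"
  have i1: "a \<in> \<int>" "b \<in> \<int>" "c \<in> \<int>" and n1: "a \<noteq> 0 \<or> b \<noteq> 0 \<or> c \<noteq> 0"
    using v(2) nr(2) by (auto simp: quat_int_def quat_Reals_iff a_def b_def c_def)
  \<comment> \<open>Four times a rotation by 60 degrees about the k-axis, as the squared norm of the
    conjugating quaternion is 4.\<close>
  have e1: "imag (kconj (Quat (sqrt 3) 0 0 1) * v\<^sub>1 * Quat (sqrt 3) 0 0 1)
     = Quat 0 (2 * a + 2 * sqrt 3 * b) (2 * b - 2 * sqrt 3 * a) (4 * c)"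
    by (simp add: imag_def quat_eq_iff times_quat_def kconj_quat_def a_def b_def c_def algebra_simps)
  have "Quat 0 x y z * Quat 0 (2 * a + 2 * sqrt 3 * b) (2 * b - 2 * sqrt 3 * a) (4 * c)
      = Quat 0 (2 * a + 2 * sqrt 3 * b) (2 * b - 2 * sqrt 3 * a) (4 * c) * Quat 0 x y z"
    using comm[OF H0 H1] unfolding v0 e1 .
  then have c1: "x * b - y * a = sqrt 3 * (x * a + y * b)"
      "y * (2 * c) = z * (b - sqrt 3 * a)" "x * (2 * c) = z * (a + sqrt 3 * b)"
    by (simp_all add: quat_eq_iff times_quat_def algebra_simps)
  \<comment> \<open>An integer equals an integer times an irrational number, so both vanish.\<close>
  have xb: "x * b - y * a = 0" "x * a + y * b = 0"
    by (rule sqrt_3_Ints[OF _ _ c1(1)]; use i0 i1 in auto)+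
  \<comment> \<open>Multiplicativity of the complex norm. One of the two projections to the ij-plane
    vanishes, and either way \<open>imag v\<^sub>0\<close> lies on the k-axis.\<close>
  have "(x\<^sup>2 + y\<^sup>2) * (a\<^sup>2 + b\<^sup>2) = (x * b - y * a)\<^sup>2 + (x * a + y * b)\<^sup>2"
    by algebra
  then have "(x\<^sup>2 + y\<^sup>2) * (a\<^sup>2 + b\<^sup>2) = 0" unfolding xb by simp
  then consider "x = 0" "y = 0" | "a = 0" "b = 0"
    by (auto simp: sum_power2_eq_zero_iff)
  then have "x = 0 \<and> y = 0" using c1(2,3) n1 by cases auto
  then have xy: "x = 0" "y = 0" by simp_all
  then have z: "z \<noteq> 0" using n0 by simp
  define a' b' c' where "a' = qi v\<^sub>2" and "b' = qj v\<^sub>2" and "c' = qk v\<^sub>2"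
  have i2: "a' \<in> \<int>" "b' \<in> \<int>" "c' \<in> \<int>" and n2: "a' \<noteq> 0 \<or> b' \<noteq> 0 \<or> c' \<noteq> 0"
    using v(3) nr(3) by (auto simp: quat_int_def quat_Reals_iff a'_def b'_def c'_def)
  have e2: "imag (kconj (Quat (sqrt 3) 1 0 0) * v\<^sub>2 * Quat (sqrt 3) 1 0 0)
     = Quat 0 (4 * a') (2 * b' + 2 * sqrt 3 * c') (2 * c' - 2 * sqrt 3 * b')"
    by (simp add: imag_def quat_eq_iff times_quat_def kconj_quat_def a'_def b'_def c'_def algebra_simps)
  have "Quat 0 0 0 z * Quat 0 (4 * a') (2 * b' + 2 * sqrt 3 * c') (2 * c' - 2 * sqrt 3 * b')
      = Quat 0 (4 * a') (2 * b' + 2 * sqrt 3 * c') (2 * c' - 2 * sqrt 3 * b') * Quat 0 0 0 z"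
    using comm[OF H0 H2] unfolding v0 e2 xy .
  \<comment> \<open>A vector parallel to the k-axis has no i- and no j-component; the second
    rotation, about the i-axis, makes this impossible for a nonzero integral vector.\<close>
  then have "z * a' = 0" "z * (b' + sqrt 3 * c') = 0"
    by (simp_all add: quat_eq_iff times_quat_def algebra_simps)
  then have "a' = 0" and bc: "- b' = sqrt 3 * c'" using z by auto
  moreover have "- b' = 0" "c' = 0"
    by (rule sqrt_3_Ints[OF _ _ bc]; use i2 in auto)+
  ultimately show False using n2 by simp
qed

end

text \<open>\<open>D\<close> is a representation of the Lie algebra of imaginary quaternions. Two
  axes suffice in \<open>irreducible\<close>, since coordinate permutations carry them to all other
  pairs.\<close>

locale lie_block_action = block_action +
  fixes i\<^sub>0 j\<^sub>0 :: 'b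
  assumes D_add: "D (p + q) b = D p b + D q b"
    and D_scaleR: "D (c *\<^sub>R p) b = c *\<^sub>R D p b"
    and D_in: "qre p = 0 \<Longrightarrow> b \<in> B \<Longrightarrow> D p b \<in> B"
    and D_commutator: "D (p * q - q * p) b = D p (D q b) - D q (D p b)"
    and i0_j0: "i\<^sub>0 \<noteq> j\<^sub>0"
    and irreducible: "\<lbrakk>right_subspace W; \<And>w x. qre w = 0 \<Longrightarrow> x \<in> W \<Longrightarrow> T w x \<in> W;
      x \<in> W; x $ i\<^sub>0 \<noteq> 0\<rbrakk> \<Longrightarrow> axis i\<^sub>0 1 \<in> W \<and> axis j\<^sub>0 1 \<in> W"
begin

lemma stabilizer_lie_algebra:
  assumes W: "right_subspace W"
  shows "imaginary_lie_algebra {w. qre w = 0 \<and> (\<forall>x\<in>W. T w x \<in> W)}"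
proof
  fix p q :: quat and c :: real
  assume p: "p \<in> {w. qre w = 0 \<and> (\<forall>x\<in>W. T w x \<in> W)}"
  then show "qre p = 0" by simp
  show "c *\<^sub>R p \<in> {w. qre w = 0 \<and> (\<forall>x\<in>W. T w x \<in> W)}"
    using p right_subspace_scaleR[OF W] by (simp add: T_def D_scaleR upd_0_scaleR)
  assume q: "q \<in> {w. qre w = 0 \<and> (\<forall>x\<in>W. T w x \<in> W)}"
  show "p + q \<in> {w. qre w = 0 \<and> (\<forall>x\<in>W. T w x \<in> W)}"
    using p q W by (simp add: T_def D_add upd_0_add right_subspace_def)
  have "T (p * q - q * p) x = T p (T q x) - T q (T p x)" for x
    using p q upd_diff[of 0 0] by (simp add: T_def D_commutator pack_upd D_in pack_in)
  then show "p * q - q * p \<in> {w. qre w = 0 \<and> (\<forall>x\<in>W. T w x \<in> W)}"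
    using p q right_subspace_diff[OF W] by (simp add: times_quat_def)
qed

text \<open>If \<open>u\<close> fixes the image of \<open>W\<close> under \<open>r\<close>, then
  \<open>kconj r * u * r\<close> fixes \<open>W\<close>. The three choices of \<open>r\<close> feed
  \<open>all_imaginary_of_int\<close>, so the stabilizer of \<open>W\<close> is the whole Lie
  algebra.\<close>

lemma T_stable:
  assumes W: "right_subspace W"
    and bad: "\<And>r. r \<in> {1, Quat (sqrt 3) 0 0 1, Quat (sqrt 3) 1 0 0} \<Longrightarrow>
      \<exists>u\<in>words. u \<notin> \<real> \<and> \<rho> u ` \<rho> r ` W = \<rho> r ` W"
    and w: "qre w = 0" and x: "x \<in> W"
  shows "T w x \<in> W"
proof -
  let ?H = "{w. qre w = 0 \<and> (\<forall>x\<in>W. T w x \<in> W)}"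
  interpret imaginary_lie_algebra ?H by (rule stabilizer_lie_algebra[OF W])
  have H: "imag (kconj r * u * r) \<in> ?H"
    if r: "r \<noteq> 0" and u: "u \<in> words" "\<rho> u ` \<rho> r ` W = \<rho> r ` W" for r u
  proof -
    have u0: "u \<noteq> 0" using u(1) by (rule words_nonzero)
    have "\<rho> (kconj r * u * r) ` W = \<rho> (kconj r) ` \<rho> u ` \<rho> r ` W"
      using r u0 by (simp add: rho_comp image_image mult.assoc)
    also have "\<dots> = W" unfolding u(2) using r by (simp add: rho_kconj image_image)
    finally have fixed: "\<rho> (kconj r * u * r) ` W = W" .
    \<comment> \<open>Conjugation only rescales the real part, so it stays nonzero as
      \<open>stable_T\<close> requires.\<close>
    have "qre (kconj r * u * r) = (norm r)\<^sup>2 * qre u"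
      unfolding norm_quat_squared
      by (simp add: times_quat_def algebra_simps power2_eq_square)
    then have "qre (kconj r * u * r) \<noteq> 0" using r words_qre_nonzero[OF u(1)] by simp
    then show ?thesis using stable_T[OF _ W fixed] by (simp add: imag_def)
  qed
  obtain u0 where u0: "u0 \<in> words" "u0 \<notin> \<real>" "\<rho> u0 ` \<rho> 1 ` W = \<rho> 1 ` W"
    using bad[of 1] by auto
  obtain u1 where u1: "u1 \<in> words" "u1 \<notin> \<real>"
      "\<rho> u1 ` \<rho> (Quat (sqrt 3) 0 0 1) ` W = \<rho> (Quat (sqrt 3) 0 0 1) ` W"
    using bad[of "Quat (sqrt 3) 0 0 1"] by auto
  obtain u2 where u2: "u2 \<in> words" "u2 \<notin> \<real>"
      "\<rho> u2 ` \<rho> (Quat (sqrt 3) 1 0 0) ` W = \<rho> (Quat (sqrt 3) 1 0 0) ` W"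
    using bad[of "Quat (sqrt 3) 1 0 0"] by auto
  have nz: "Quat (sqrt 3) 0 0 1 \<noteq> 0" "Quat (sqrt 3) 1 0 0 \<noteq> 0" by (simp_all add: zero_quat_def)
  have "kconj (1::quat) = 1" by (simp add: quat_simps)
  then have "imag u0 \<in> ?H" using H[OF _ u0(1,3)] by simp
  then have "w \<in> ?H"
    using all_imaginary_of_int[OF words_int[OF u0(1)] words_int[OF u1(1)] words_int[OF u2(1)]
        u0(2) u1(2) u2(2) _ H[OF nz(1) u1(1,3)] H[OF nz(2) u2(1,3)] w] by blast
  then show ?thesis using x by blast
qed

text \<open>The finite set of movers combines the three rotations with all coordinate permutations:
  the former yield the full Lie algebra, the latter reach every pair of coordinates.\<close>

theorem paradoxical_lie_block:
  assumes ds: "length ds \<ge> 2" "0 < hd ds" "sorted_wrt (<) ds" "last ds = CARD('b)"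
  shows "paradoxical (isometry_group :: ('a^'b \<Rightarrow> 'a^'b) monoid) (flag_action ds) (flag_manifold ds)"
proof -
  let ?R = "{1, Quat (sqrt 3) 0 0 1, Quat (sqrt 3) 1 0 0}"
  let ?S = "(\<lambda>(r, \<sigma>). \<rho> r \<circ> permute \<sigma>) ` (?R \<times> {\<sigma>. bij \<sigma>})"
  interpret I: group "isometry_group :: ('a^'b \<Rightarrow> 'a^'b) monoid" by (rule group_isometry_group)
  have nz: "r \<noteq> 0" if "r \<in> ?R" for r using that by (auto simp: quat_eq_iff one_quat_def)
  show ?thesis
  proof (rule paradoxical_flag_manifold[OF ds])
    show "finite ?S" by simp
    show "?S \<subseteq> carrier isometry_group"
      using I.m_closed[OF rho_isometry[OF nz] permute_isometry] by (auto simp: isometry_group_def)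
    fix V :: "('a^'b) set" assume V: "right_subspace V"
      and bad: "\<forall>g\<in>?S. \<exists>u\<in>words. u \<notin> \<real> \<and> \<rho> u ` g ` V = g ` V"
    have step: "axis a 1 \<in> V \<and> axis b 1 \<in> V"
      if x: "x \<in> V" "x $ a \<noteq> 0" and "a \<noteq> b" for x a b
    proof -
      obtain \<sigma> where \<sigma>: "bij \<sigma>" "\<sigma> i\<^sub>0 = a" "\<sigma> j\<^sub>0 = b"
        using obtain_permutation[OF i0_j0 \<open>a \<noteq> b\<close>] by blast
      let ?W = "permute \<sigma> ` V"
      have W: "right_subspace ?W"
        by (rule isometry_right_subspace_image[OF permute_isometry[OF \<sigma>(1)] V])
      have "\<exists>u\<in>words. u \<notin> \<real> \<and> \<rho> u ` \<rho> r ` ?W = \<rho> r ` ?W" if "r \<in> ?R" for r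
      proof -
        have "\<rho> r \<circ> permute \<sigma> \<in> ?S"
          using that \<sigma>(1) by (intro image_eqI[of _ _ "(r, \<sigma>)"]) auto
        from bspec[OF bad this] show ?thesis by (simp only: image_comp)
      qed
      then have stable: "\<And>w x. qre w = 0 \<Longrightarrow> x \<in> ?W \<Longrightarrow> T w x \<in> ?W"
        using T_stable[OF W] by blast
      have "permute \<sigma> x \<in> ?W" "permute \<sigma> x $ i\<^sub>0 \<noteq> 0" using x \<sigma> by (auto simp: permute_def)
      from irreducible[OF W stable this] have "axis i\<^sub>0 1 \<in> ?W" "axis j\<^sub>0 1 \<in> ?W" by blast+
      moreover have pa: "permute \<sigma> (axis a (1::'a)) = axis i\<^sub>0 1" "permute \<sigma> (axis b (1::'a)) = axis j\<^sub>0 1"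
        unfolding \<sigma>(2,3)[symmetric] by (rule permute_axis[OF \<sigma>(1)])+
      moreover have "inj (permute \<sigma> :: 'a^'b \<Rightarrow> 'a^'b)"
        by (rule isometry_inj[OF permute_isometry[OF \<sigma>(1)]])
      ultimately show ?thesis by (metis inj_image_mem_iff)
    qed
    have "card {i\<^sub>0, j\<^sub>0} \<le> CARD('b)" by (intro card_mono) auto
    then have "CARD('b) \<ge> 2" using i0_j0 by simp
    then show "V = {0} \<or> V = UNIV" by (rule right_subspace_trivialI[OF V]) (rule step)
  qed
qed

end

lemma norm_vec_eqI:
  fixes x y :: "'a::real_normed_vector ^ 'n"
  assumes "\<And>m. m \<notin> A \<Longrightarrow> x $ m = y $ m"
    and "(\<Sum>m\<in>A. (norm (x $ m))\<^sup>2) = (\<Sum>m\<in>A. (norm (y $ m))\<^sup>2)"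
  shows "norm x = norm y"
proof -
  have "(\<Sum>m\<in>UNIV - A. (norm (x $ m))\<^sup>2) = (\<Sum>m\<in>UNIV - A. (norm (y $ m))\<^sup>2)"
    using assms(1) by (intro sum.cong) auto
  then have "(norm x)\<^sup>2 = (norm y)\<^sup>2"
    unfolding norm_vec_power2 using assms(2) by (simp add: sum.subset_diff[of A UNIV])
  then show ?thesis by simp
qed

section \<open>Rotations of three real coordinates\<close>

text \<open>Three coordinates form an imaginary quaternion, on which unit quaternions act by
  conjugation; \<open>D\<close> is the adjoint representation.\<close>

theorem paradoxical_real:
  fixes ds :: "nat list"
  assumes ds: "length ds \<ge> 2" "0 < hd ds" "sorted_wrt (<) ds" "last ds = CARD('n::finite)"
    and n: "CARD('n) \<ge> 3"
  shows "paradoxical (isometry_group :: (real^'n \<Rightarrow> real^'n) monoid)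
    (flag_action ds) (flag_manifold ds)"
proof -
  obtain A where "A \<subseteq> (UNIV :: 'n set)" "card A = 3"
    using n by (rule obtain_subset_with_card_n)
  then obtain i j k :: 'n where ijk: "i \<noteq> j" "i \<noteq> k" "j \<noteq> k"
    unfolding card_3_iff by blast
  define pack where "pack x = Quat 0 (x $ i) (x $ j) (x $ k)" for x :: "real^'n"
  define upd where "upd x q = (\<chi> m. if m = i then qi q else if m = j then qj q else
      if m = k then qk q else x $ m)" for x :: "real^'n" and q
  define L where "L u q = inverse ((norm u)\<^sup>2) *\<^sub>R (u * q * kconj u)" for u q :: quat
  define D where "D w q = w * q - q * w" for w q :: quat
  interpret block_action pack upd "{q. qre q = 0}" L D
  proof
    fix x y :: "real^'n" and p q u v :: quat and c b :: real
    show "pack x \<in> {q. qre q = 0}" by (simp add: pack_def)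
    show "pack (upd x q) = q" if "q \<in> {q. qre q = 0}"
      using that ijk by (simp add: pack_def upd_def quat_eq_iff)
    show "upd (upd x p) q = upd x q" by (simp add: upd_def vec_eq_iff)
    show "upd x (pack x) = x" by (simp add: upd_def vec_eq_iff pack_def)
    show "upd (x + y) (p + q) = upd x p + upd y q" by (simp add: upd_def vec_eq_iff)
    show "upd (c *\<^sub>R x) (c *\<^sub>R p) = c *\<^sub>R upd x p" by (simp add: upd_def vec_eq_iff)
    show "pack (x + y) = pack x + pack y" by (simp add: pack_def quat_eq_iff)
    show "norm (upd x q) = norm x" if "q \<in> {q. qre q = 0}" "norm q = norm (pack x)"
    proof (rule norm_vec_eqI[of "{i, j, k}"])
      have "(norm q)\<^sup>2 = (norm (pack x))\<^sup>2" using that by simp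
      then show "(\<Sum>m\<in>{i, j, k}. (norm (upd x q $ m))\<^sup>2) = (\<Sum>m\<in>{i, j, k}. (norm (x $ m))\<^sup>2)"
        using ijk that(1) by (simp add: norm_quat_squared pack_def upd_def)
    qed (simp add: upd_def)
    show "L u q \<in> {q. qre q = 0}" if "u \<noteq> 0" "q \<in> {q. qre q = 0}"
      using that by (simp add: L_def times_quat_def algebra_simps)
    show "norm (L u q) = norm q" if "u \<noteq> 0"
      using that by (simp add: L_def norm_mult power2_eq_square field_simps)
    show "L (u * v) q = L u (L v q)"
      by (simp add: L_def norm_mult kconj_quat_mult mult.assoc power_mult_distrib)
    show "L (of_real c) q = q" if "c > 0"
    proof -
      have "kconj (of_real c :: quat) = of_real c" by (simp add: quat_simps)
      moreover have "inverse c * inverse c * (c * c) = 1" using that by (simp add: field_simps)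
      ultimately show ?thesis using that
        by (simp add: L_def of_real_def power2_eq_square)
    qed
    show "L u (p + q) = L u p + L u q" by (simp add: L_def algebra_simps)
    show "upd (rscale x b) (L u (pack (rscale x b))) = rscale (upd x (L u (pack x))) b"
    proof -
      have "pack (rscale x b) = b *\<^sub>R pack x" by (simp add: pack_def rscale_def quat_eq_iff)
      then have "L u (pack (rscale x b)) = b *\<^sub>R L u (pack x)" by (simp add: L_def)
      then show ?thesis by (simp add: upd_def rscale_def vec_eq_iff)
    qed
    show "\<exists>c. c \<noteq> 0 \<and> (\<forall>q. L u q - L (kconj u) q = c *\<^sub>R D (imag u) q)" if "qre u \<noteq> 0"
    \<comment> \<open>For u = a + v with a real and v imaginary, only the mixed terms 2a(vq - qv)
      survive in the difference.\<close>
    proof (intro exI[of _ "2 * qre u * inverse ((norm u)\<^sup>2)"] conjI allI)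
      show "2 * qre u * inverse ((norm u)\<^sup>2) \<noteq> 0" using that by auto
      fix q
      have "u * q * kconj u - kconj u * q * u = (2 * qre u) *\<^sub>R D (imag u) q"
        by (simp add: D_def imag_def quat_eq_iff times_quat_def algebra_simps)
      then show "L u q - L (kconj u) q = (2 * qre u * inverse ((norm u)\<^sup>2)) *\<^sub>R D (imag u) q"
        by (simp add: L_def mult.commute flip: scaleR_diff_right)
    qed
  qed
  interpret lie_block_action pack upd "{q. qre q = 0}" L D i j
  proof
    show "D (p + q) b = D p b + D q b" "D (c *\<^sub>R p) b = c *\<^sub>R D p b"
      "D (p * q - q * p) b = D p (D q b) - D q (D p b)" for p q b c
      by (simp_all add: D_def algebra_simps)
    show "D p b \<in> {q. qre q = 0}" if "qre p = 0" "b \<in> {q. qre q = 0}" for p b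
      using that by (simp add: D_def times_quat_def)
    show "i \<noteq> j" by fact
    fix W :: "(real^'n) set" and x
    assume W: "right_subspace W" and st: "\<And>w x. qre w = 0 \<Longrightarrow> x \<in> W \<Longrightarrow> T w x \<in> W"
      and x: "x \<in> W" "x $ i \<noteq> 0"
    have add: "y + z \<in> W" if "y \<in> W" "z \<in> W" for y z
      using W that by (simp add: right_subspace_def)
    note u0 = upd_0_add upd_0_scaleR
    define p where "p = pack x"
    have p: "qre p = 0" "qi p \<noteq> 0" using x(2) by (auto simp: p_def pack_def)
    have TT: "upd 0 (D v (D w p)) \<in> W" if "qre v = 0" "qre w = 0" for v w
    proof -
      have "T v (T w x) \<in> W" using st x(1) that by blast
      moreover have "qre (D w p) = 0" using that p by (simp add: D_def times_quat_def)
      ultimately show ?thesis using ijk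
        by (simp add: T_def p_def pack_upd)
    qed
    let ?i = "Quat 0 1 0 0" and ?j = "Quat 0 0 1 0" and ?k = "Quat 0 0 0 1"
    \<comment> \<open>The Casimir operator acts on imaginary quaternions as -8; it cuts the block
      component out of \<open>x\<close>.\<close>
    have "p = (-1/8) *\<^sub>R (D ?i (D ?i p) + D ?j (D ?j p) + D ?k (D ?k p))"
      using p by (simp add: D_def quat_eq_iff times_quat_def)
    moreover have "upd 0 ((-1/8) *\<^sub>R (D ?i (D ?i p) + D ?j (D ?j p) + D ?k (D ?k p))) \<in> W"
      unfolding u0 by (intro right_subspace_scaleR[OF W] add TT) simp_all
    ultimately have pW: "upd 0 p \<in> W" by simp
    have all: "upd 0 q \<in> W" if q: "qre q = 0" for q
    proof -
      define N where "N = 4 * ((qi p)\<^sup>2 + (qj p)\<^sup>2 + (qk p)\<^sup>2)"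
      define d where "d = 4 * (qi p * qi q + qj p * qj q + qk p * qk q)"
      define w where "w = p * q - q * p"
      have "(qi p)\<^sup>2 > 0" using p(2) by simp
      then have N: "N \<noteq> 0" unfolding N_def by (smt (verit) zero_le_power2)
      have w: "qre w = 0" using p q by (simp add: w_def times_quat_def)
      \<comment> \<open>The triple product formula for (p x q) x p, solved for
        \<open>q\<close>.\<close>
      have "N *\<^sub>R q = d *\<^sub>R p + D w p"
        using p(1) q unfolding N_def d_def w_def
        by (simp add: D_def quat_eq_iff times_quat_def power2_eq_square) (auto simp: algebra_simps)
      moreover have "upd 0 (D w p) \<in> W" using st[OF w x(1)] by (simp add: T_def p_def)
      ultimately have "N *\<^sub>R upd 0 q \<in> W"
        using u0 pW by (metis add right_subspace_scaleR[OF W])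
      then have "inverse N *\<^sub>R (N *\<^sub>R upd 0 q) \<in> W" by (rule right_subspace_scaleR[OF W])
      then show ?thesis using N by simp
    qed
    have "upd 0 ?i = axis i 1" "upd 0 ?j = axis j 1"
      using ijk by (auto simp: upd_def axis_def vec_eq_iff)
    then show "axis i 1 \<in> W \<and> axis j 1 \<in> W" using all[of ?i] all[of ?j] by simp
  qed
  show ?thesis by (rule paradoxical_lie_block[OF ds])
qed

section \<open>The special unitary group on two complex coordinates\<close>

theorem paradoxical_complex:
  fixes ds :: "nat list"
  assumes ds: "length ds \<ge> 2" "0 < hd ds" "sorted_wrt (<) ds" "last ds = CARD('n::finite)"
    and n: "CARD('n) \<ge> 2"
  shows "paradoxical (isometry_group :: (complex^'n \<Rightarrow> complex^'n) monoid)
    (flag_action ds) (flag_manifold ds)"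
proof -
  obtain A where "A \<subseteq> (UNIV :: 'n set)" "card A = 2"
    using n by (rule obtain_subset_with_card_n)
  then obtain i j :: 'n where ij: "i \<noteq> j"
    unfolding card_2_iff by blast
  \<comment> \<open>The pair (z, w) is read as z + jw, whence the sign, since ji = -k. Right
    multiplication by complex scalars is then right multiplication of quaternions and commutes with
    the left action of \<open>u\<close>.\<close>
  define pack where "pack x = Quat (Re (x $ i)) (Im (x $ i)) (Re (x $ j)) (- Im (x $ j))"
    for x :: "complex^'n"
  define upd where "upd x q = (\<chi> m. if m = i then Complex (qre q) (qi q) else
      if m = j then Complex (qj q) (- qk q) else x $ m)" for x :: "complex^'n" and q
  define L where "L u q = inverse (norm u) *\<^sub>R (u * q)" for u q :: quat
  define D where "D w q = w * q" for w q :: quat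
  interpret block_action pack upd UNIV L D
  proof
    fix x y :: "complex^'n" and p q u v :: quat and c :: real and b :: complex
    show "pack x \<in> UNIV" by simp
    show "pack (upd x q) = q" using ij by (simp add: pack_def upd_def quat_eq_iff)
    show "upd (upd x p) q = upd x q" by (simp add: upd_def vec_eq_iff)
    show "upd x (pack x) = x" by (simp add: upd_def vec_eq_iff pack_def)
    show "upd (x + y) (p + q) = upd x p + upd y q"
      by (simp add: upd_def vec_eq_iff complex_eq_iff)
    show "upd (c *\<^sub>R x) (c *\<^sub>R p) = c *\<^sub>R upd x p"
      by (simp add: upd_def vec_eq_iff complex_eq_iff)
    show "pack (x + y) = pack x + pack y" by (simp add: pack_def quat_eq_iff)
    show "norm (upd x q) = norm x" if "norm q = norm (pack x)"
    proof (rule norm_vec_eqI[of "{i, j}"])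
      have "(norm q)\<^sup>2 = (norm (pack x))\<^sup>2" using that by simp
      then show "(\<Sum>m\<in>{i, j}. (norm (upd x q $ m))\<^sup>2) = (\<Sum>m\<in>{i, j}. (norm (x $ m))\<^sup>2)"
        using ij by (simp add: norm_quat_squared pack_def upd_def cmod_power2)
    qed (simp add: upd_def)
    show "L u q \<in> UNIV" by simp
    show "norm (L u q) = norm q" if "u \<noteq> 0" using that by (simp add: L_def norm_mult)
    show "L (u * v) q = L u (L v q)" by (simp add: L_def norm_mult mult.assoc)
    show "L (of_real c) q = q" if "c > 0" using that by (simp add: L_def of_real_def)
    show "L u (p + q) = L u p + L u q" by (simp add: L_def algebra_simps)
    show "upd (rscale x b) (L u (pack (rscale x b))) = rscale (upd x (L u (pack x))) b"
    proof -
      have "pack (rscale x b) = pack x * Quat (Re b) (Im b) 0 0"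
        by (simp add: pack_def rscale_def quat_eq_iff times_quat_def)
      then have "L u (pack (rscale x b)) = L u (pack x) * Quat (Re b) (Im b) 0 0"
        by (simp add: L_def mult.assoc)
      then show ?thesis
        by (simp add: upd_def rscale_def vec_eq_iff complex_eq_iff times_quat_def)
    qed
    show "\<exists>c. c \<noteq> 0 \<and> (\<forall>q. L u q - L (kconj u) q = c *\<^sub>R D (imag u) q)" if "qre u \<noteq> 0"
    proof (intro exI[of _ "2 * inverse (norm u)"] conjI allI)
      show "2 * inverse (norm u) \<noteq> 0" using that by auto
      fix q
      have "u - kconj u = 2 *\<^sub>R imag u" by (simp add: imag_def quat_eq_iff)
      then have "u * q - kconj u * q = 2 *\<^sub>R D (imag u) q"
        by (metis D_def left_diff_distrib mult_scaleR_left)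
      then show "L u q - L (kconj u) q = (2 * inverse (norm u)) *\<^sub>R D (imag u) q"
        by (simp add: L_def mult.commute flip: scaleR_diff_right)
    qed
  qed
  interpret lie_block_action pack upd UNIV L D i j
  proof
    show "D (p + q) b = D p b + D q b" "D (c *\<^sub>R p) b = c *\<^sub>R D p b"
      "D (p * q - q * p) b = D p (D q b) - D q (D p b)" "D p b \<in> UNIV" for p q b c
      by (simp_all add: D_def algebra_simps)
    show "i \<noteq> j" by fact
    fix W :: "(complex^'n) set" and x
    assume W: "right_subspace W" and st: "\<And>w x. qre w = 0 \<Longrightarrow> x \<in> W \<Longrightarrow> T w x \<in> W"
      and x: "x \<in> W" "x $ i \<noteq> 0"
    note u0 = upd_0_add upd_0_scaleR
    define p where "p = pack x"
    have p: "p \<noteq> 0" using x(2) by (auto simp: p_def pack_def quat_eq_iff complex_eq_iff)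
    have "T (Quat 0 1 0 0) (T (Quat 0 1 0 0) x) \<in> W" using st x(1) by simp
    \<comment> \<open>Applying i twice gives -1 on the block and 0 outside, which isolates the block
      component of \<open>x\<close>.\<close>
    moreover have "Quat 0 1 0 0 * (Quat 0 1 0 0 * p) = (-1) *\<^sub>R p"
      by (simp add: quat_eq_iff times_quat_def)
    ultimately have "(-1) *\<^sub>R upd 0 p \<in> W"
      using u0(2)[of "-1" p] by (simp add: T_def D_def pack_upd flip: p_def)
    then have "(-1) *\<^sub>R (-1) *\<^sub>R upd 0 p \<in> W" by (rule right_subspace_scaleR[OF W])
    then have pW: "upd 0 p \<in> W" by simp
    have all: "upd 0 q \<in> W" for q
    proof -
      \<comment> \<open>Left multiplication by \<open>w\<close> takes \<open>p\<close> to
        \<open>q\<close>; its real part rescales \<open>p\<close> and its imaginary part acts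
        through \<open>T\<close>.\<close>
      define w where "w = q * inverse p"
      have "w = qre w *\<^sub>R 1 + imag w" by (simp add: quat_eq_iff imag_def one_quat_def)
      then have "w * p = qre w *\<^sub>R p + imag w * p"
        by (metis distrib_right mult_1 mult_scaleR_left)
      moreover have "w * p = q" using p by (simp add: w_def mult.assoc)
      ultimately have "upd 0 q = qre w *\<^sub>R upd 0 p + upd 0 (imag w * p)" using u0 by simp
      moreover have "upd 0 (imag w * p) \<in> W"
        using st[of "imag w" x] x(1) by (simp add: T_def D_def p_def imag_def)
      ultimately show ?thesis
        using W right_subspace_scaleR[OF W pW] by (simp add: right_subspace_def)
    qed
    have "upd 0 (Quat 1 0 0 0) = axis i 1" "upd 0 (Quat 0 0 1 0) = axis j 1"
      using ij by (auto simp: upd_def axis_def vec_eq_iff complex_eq_iff)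
    then show "axis i 1 \<in> W \<and> axis j 1 \<in> W"
      using all[of "Quat 1 0 0 0"] all[of "Quat 0 0 1 0"] by simp
  qed
  show ?thesis by (rule paradoxical_lie_block[OF ds])
qed

section \<open>Unit quaternions on one quaternionic coordinate\<close>

text \<open>The block is a single coordinate over a division ring, so one non-real word already puts
  its axis into a stable subspace. A reflection mixing two coordinates then yields a second
  axis.\<close>

theorem paradoxical_quat:
  fixes ds :: "nat list"
  assumes ds: "length ds \<ge> 2" "0 < hd ds" "sorted_wrt (<) ds" "last ds = CARD('n::finite)"
    and n: "CARD('n) \<ge> 2"
  shows "paradoxical (isometry_group :: (quat^'n \<Rightarrow> quat^'n) monoid)
    (flag_action ds) (flag_manifold ds)"
proof -
  obtain A where "A \<subseteq> (UNIV :: 'n set)" "card A = 2"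
    using n by (rule obtain_subset_with_card_n)
  then obtain i j :: 'n where ij: "i \<noteq> j"
    unfolding card_2_iff by blast
  define upd where "upd x q = (\<chi> m. if m = i then q else x $ m)" for x :: "quat^'n" and q
  define L where "L u q = inverse (norm u) *\<^sub>R (u * q)" for u q :: quat
  define D where "D w q = w * q" for w q :: quat
  interpret block_action "\<lambda>x. x $ i" upd UNIV L D
  proof
    fix x y :: "quat^'n" and p q u v :: quat and c :: real and b :: quat
    show "x $ i \<in> UNIV" by simp
    show "upd x q $ i = q" by (simp add: upd_def)
    show "upd (upd x p) q = upd x q" by (simp add: upd_def vec_eq_iff)
    show "upd x (x $ i) = x" by (simp add: upd_def vec_eq_iff)
    show "upd (x + y) (p + q) = upd x p + upd y q" by (simp add: upd_def vec_eq_iff)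
    show "upd (c *\<^sub>R x) (c *\<^sub>R p) = c *\<^sub>R upd x p" by (simp add: upd_def vec_eq_iff)
    show "(x + y) $ i = x $ i + y $ i" by simp
    show "norm (upd x q) = norm x" if "norm q = norm (x $ i)"
      using that by (intro norm_vec_eqI[of "{i}"]) (simp_all add: upd_def)
    show "L u q \<in> UNIV" by simp
    show "norm (L u q) = norm q" if "u \<noteq> 0" using that by (simp add: L_def norm_mult)
    show "L (u * v) q = L u (L v q)" by (simp add: L_def norm_mult mult.assoc)
    show "L (of_real c) q = q" if "c > 0" using that by (simp add: L_def of_real_def)
    show "L u (p + q) = L u p + L u q" by (simp add: L_def algebra_simps)
    show "upd (rscale x b) (L u (rscale x b $ i)) = rscale (upd x (L u (x $ i))) b"
      by (simp add: upd_def rscale_def vec_eq_iff L_def mult.assoc)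
    show "\<exists>c. c \<noteq> 0 \<and> (\<forall>q. L u q - L (kconj u) q = c *\<^sub>R D (imag u) q)" if "qre u \<noteq> 0"
    proof (intro exI[of _ "2 * inverse (norm u)"] conjI allI)
      show "2 * inverse (norm u) \<noteq> 0" using that by auto
      fix q
      have "u - kconj u = 2 *\<^sub>R imag u" by (simp add: imag_def quat_eq_iff)
      then have "u * q - kconj u * q = 2 *\<^sub>R D (imag u) q"
        by (metis D_def left_diff_distrib mult_scaleR_left)
      then show "L u q - L (kconj u) q = (2 * inverse (norm u)) *\<^sub>R D (imag u) q"
        by (simp add: L_def mult.commute flip: scaleR_diff_right)
    qed
  qed
  have proj: "axis i 1 \<in> W"
    if W: "right_subspace W" and u: "u \<in> words" "u \<notin> \<real>" "\<rho> u ` W = W"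
      and x: "x \<in> W" "x $ i \<noteq> 0" for W u x
  proof -
    have "T (imag u) x \<in> W" by (rule stable_T[OF words_qre_nonzero[OF u(1)] W u(3) x(1)])
    \<comment> \<open>The vector \<open>T (imag u) x\<close> is supported on coordinate
      \<open>i\<close>; the right scalar normalises its entry to 1.\<close>
    then have "rscale (T (imag u) x) (inverse (imag u * x $ i)) \<in> W"
      using W by (simp add: right_subspace_def)
    moreover have "imag u \<noteq> 0" using u(2) by (auto simp: quat_Reals_iff imag_def quat_eq_iff)
    then have "imag u * x $ i \<noteq> 0" using x(2) by simp
    then have "rscale (T (imag u) x) (inverse (imag u * x $ i)) = axis i 1"
      by (simp add: T_def D_def upd_def rscale_def axis_def vec_eq_iff)
    ultimately show ?thesis by simp
  qed
  define h where "h = 1 / sqrt (2::real)"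
  have hh: "h * h = 1 / 2" by (simp add: h_def)
  \<comment> \<open>The normalised Hadamard matrix on coordinates \<open>i\<close> and
    \<open>j\<close>, an involution.\<close>
  define R where "R x = (\<chi> m. if m = i then h *\<^sub>R (x $ i + x $ j) else
      if m = j then h *\<^sub>R (x $ i - x $ j) else x $ m)" for x :: "quat^'n"
  have RR: "R (R x) = x" for x
  proof -
    have *: "h *\<^sub>R (h *\<^sub>R (a + b) + h *\<^sub>R (a - b)) = a" "h *\<^sub>R (h *\<^sub>R (a + b) - h *\<^sub>R (a - b)) = b"
      for a b :: quat
      using hh by (simp_all add: algebra_simps flip: scaleR_add_left)
    then show ?thesis using ij by (simp add: R_def vec_eq_iff)
  qed
  have R_iso: "R \<in> carrier isometry_group"
  proof (rule isometryI)
    show "right_linear R"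
      by (simp add: right_linear_def R_def rscale_def vec_eq_iff algebra_simps)
    show "norm (R x) = norm x" for x
    proof (rule norm_vec_eqI[of "{i, j}"])
      have "(norm (h *\<^sub>R (a + b)))\<^sup>2 + (norm (h *\<^sub>R (a - b)))\<^sup>2 = (norm a)\<^sup>2 + (norm b)\<^sup>2" for a b :: quat
      proof -
        have h2: "\<bar>h\<bar>\<^sup>2 = 1 / 2" using hh by (simp add: power2_eq_square)
        show ?thesis
          unfolding norm_scaleR power_mult_distrib norm_quat_squared h2
          by (simp add: power2_sum power2_diff field_simps)
      qed
      then show "(\<Sum>m\<in>{i, j}. (norm (R x $ m))\<^sup>2) = (\<Sum>m\<in>{i, j}. (norm (x $ m))\<^sup>2)"
        using ij by (simp add: R_def)
    qed (simp add: R_def)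
    show "\<exists>x. R x = y" for y using RR by blast
  qed
  let ?P = "permute ` {\<sigma> :: 'n \<Rightarrow> 'n. bij \<sigma>} :: (quat^'n \<Rightarrow> quat^'n) set"
  let ?S = "?P \<union> (\<lambda>g. R \<circ> g) ` ?P"
  interpret I: group "isometry_group :: (quat^'n \<Rightarrow> quat^'n) monoid" by (rule group_isometry_group)
  show ?thesis
  proof (rule paradoxical_flag_manifold[OF ds])
    show "finite ?S" by simp
    show "?S \<subseteq> carrier isometry_group"
      using I.m_closed[OF R_iso permute_isometry] permute_isometry
      by (auto simp: isometry_group_def)
    fix V :: "(quat^'n) set" assume V: "right_subspace V"
      and bad: "\<forall>g\<in>?S. \<exists>u\<in>words. u \<notin> \<real> \<and> \<rho> u ` g ` V = g ` V"
    have step: "axis a 1 \<in> V \<and> axis b 1 \<in> V"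
      if x: "x \<in> V" "x $ a \<noteq> 0" and "a \<noteq> b" for x a b
    proof -
      obtain \<sigma> where \<sigma>: "bij \<sigma>" "\<sigma> i = a" "\<sigma> j = b"
        using obtain_permutation[OF ij \<open>a \<noteq> b\<close>] by blast
      let ?W = "permute \<sigma> ` V"
      have W: "right_subspace ?W"
        by (rule isometry_right_subspace_image[OF permute_isometry[OF \<sigma>(1)] V])
      have RW: "right_subspace (R ` ?W)"
        by (rule isometry_right_subspace_image[OF R_iso W])
      have "permute \<sigma> \<in> ?S" "R \<circ> permute \<sigma> \<in> ?S" using \<sigma>(1) by blast+
      note S = this
      obtain u where u: "u \<in> words" "u \<notin> \<real>" "\<rho> u ` ?W = ?W"
        using bspec[OF bad S(1)] by auto
      have "\<exists>v\<in>words. v \<notin> \<real> \<and> \<rho> v ` R ` ?W = R ` ?W"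
        using bspec[OF bad S(2)] by (simp only: image_comp)
      then obtain v where v: "v \<in> words" "v \<notin> \<real>" "\<rho> v ` R ` ?W = R ` ?W" by auto
      have "permute \<sigma> x \<in> ?W" "permute \<sigma> x $ i \<noteq> 0" using x \<sigma> by (auto simp: permute_def)
      from proj[OF W u this] have iW: "axis i 1 \<in> ?W" .
      then have "R (axis i 1) \<in> R ` ?W" by blast
      moreover have "R (axis i 1) $ i \<noteq> 0" using ij by (simp add: R_def axis_def h_def)
      ultimately have "axis i 1 \<in> R ` ?W" by (rule proj[OF RW v])
      then have "R (axis i 1) \<in> ?W" using RR by (metis imageE)
      \<comment> \<open>\<open>R\<close> sends the axis of \<open>i\<close> to \<open>h\<close>
        times the sum of both axes, so rescaling and subtracting leaves the axis of
        \<open>j\<close>.\<close>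
      then have "(1 / h) *\<^sub>R R (axis i 1) - axis i 1 \<in> ?W"
        by (intro right_subspace_diff[OF W] right_subspace_scaleR[OF W] iW)
      moreover have "(1 / h) *\<^sub>R R (axis i 1) - axis i 1 = axis j 1"
        using ij by (auto simp: R_def axis_def vec_eq_iff h_def)
      ultimately have "axis j 1 \<in> ?W" by simp
      note iW this
      moreover have pa: "permute \<sigma> (axis a (1::quat)) = axis i 1" "permute \<sigma> (axis b (1::quat)) = axis j 1"
        unfolding \<sigma>(2,3)[symmetric] by (rule permute_axis[OF \<sigma>(1)])+
      moreover have "inj (permute \<sigma> :: quat^'n \<Rightarrow> quat^'n)"
        by (rule isometry_inj[OF permute_isometry[OF \<sigma>(1)]])
      ultimately show ?thesis by (metis inj_image_mem_iff)
    qed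
    show "V = {0} \<or> V = UNIV" by (rule right_subspace_trivialI[OF V n]) (rule step)
  qed
qed

theorem theorem1:
  fixes ds :: "nat list"
  assumes "length ds \<ge> 2"
    and "0 < hd ds" and "sorted_wrt (<) ds" and "last ds = CARD('n::finite)"
  shows "(CARD('n) \<ge> 3 \<longrightarrow>
           paradoxical (isometry_group :: (real^'n \<Rightarrow> real^'n) monoid)
             (flag_action ds) (flag_manifold ds))
       \<and> (CARD('n) \<ge> 2 \<longrightarrow>
           paradoxical (isometry_group :: (complex^'n \<Rightarrow> complex^'n) monoid)
             (flag_action ds) (flag_manifold ds))
       \<and> (CARD('n) \<ge> 2 \<longrightarrow>
           paradoxical (isometry_group :: (quat^'n \<Rightarrow> quat^'n) monoid)
             (flag_action ds) (flag_manifold ds))"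
  using paradoxical_real[OF assms] paradoxical_complex[OF assms] paradoxical_quat[OF assms]
  by blast

end
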